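(* Let $a, b, p \in \mathbb{Q}$ with $p > 0$ and $\sqrt{p} \notin \mathbb{Q}$. Let $M$ be a polygon all of whose side lengths belong to $\mathbb{Q}[\sqrt{p}]$, and suppose that $M$ can be dissected into equal (congruent) rectangles with side ratio $y \in \mathbb{R}$. Then $M$ can be dissected into similar rectangles with side ratio $a + b\sqrt{p}$ if and only if a rectangle with side ratio $y$ can be dissected into similar rectangles with side ratio $a + b\sqrt{p}$.
   Context: $\mathbb{Q}[\sqrt{p}] = \{\alpha + \beta\sqrt{p} : \alpha, \beta \in \mathbb{Q}\}$. A polygon is a closed connected bounded part of the plane bounded by one or several pairwise disjoint non-self-intersecting closed polygonal lines (in particular, a polygon need not be simply connected). A dissection of a polygon into rectangles is a representation of it as a union of finitely many rectangles with pairwise disjoint interiors. A rectangle has side ratio $r$ if its side lengths are $s$ and $rs$ for some $s > 0$ (no matter in which order or orientation); the rectangles in a dissection into similar rectangles may have different sizes. *)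

theory Defs
  imports "HOL-Analysis.Analysis"
begin

text \<open>The Euclidean plane is modelled by the type \<^typ>\<open>complex\<close>, as in the library's
  Jordan curve theorem.\<close>

definition Qsqrt :: "real \<Rightarrow> real set" where
  "Qsqrt p = {\<alpha> + \<beta> * sqrt p | \<alpha> \<beta>. \<alpha> \<in> \<rat> \<and> \<beta> \<in> \<rat>}"

fun polyline :: "complex list \<Rightarrow> real \<Rightarrow> complex" where
  "polyline [] = linepath 0 0"
| "polyline [u] = linepath u u"
| "polyline [u, v] = linepath u v"
| "polyline (u # v # w # vs) = linepath u v +++ polyline (v # w # vs)"

definition closed_polyline :: "complex list \<Rightarrow> real \<Rightarrow> complex" where
  "closed_polyline vs = polyline (vs @ [hd vs])"

definition sides :: "complex list \<Rightarrow> (complex \<times> complex) set" where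
  "sides vs = set (zip vs (rotate1 vs))"

text \<open>\<open>polygon M C\<close>: the set \<open>M\<close> is a polygon, and \<open>C\<close> is the set of the vertex lists of its
  boundary lines. Since \<^const>\<open>simple_path\<close> excludes constant paths, each list in \<open>C\<close> has at least
  three vertices, and consecutive vertices differ. An angle of 180 degrees at a vertex is allowed.
  The condition \<open>closure (interior M) = M\<close> says that \<open>M\<close> is a part of the plane bounded by the
  lines; without it, a single closed line would itself be a polygon.\<close>

definition polygon :: "complex set \<Rightarrow> complex list set \<Rightarrow> bool" where
  "polygon M C \<longleftrightarrow>
     closed M \<and> connected M \<and> bounded M \<and> closure (interior M) = M \<and>
     finite C \<and> C \<noteq> {} \<and>
     (\<forall>vs\<in>C. simple_path (closed_polyline vs)) \<and>
     pairwise (\<lambda>vs ws. path_image (closed_polyline vs) \<inter> path_image (closed_polyline ws) = {}) C \<and>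
     frontier M = (\<Union>vs\<in>C. path_image (closed_polyline vs))"

definition rectangle_with_sides :: "real \<Rightarrow> real \<Rightarrow> complex set \<Rightarrow> bool" where
  "rectangle_with_sides l m R \<longleftrightarrow> l > 0 \<and> m > 0 \<and>
     (\<exists>z u v. u \<bullet> v = 0 \<and> norm u = l \<and> norm v = m \<and>
        R = {z + s *\<^sub>R u + t *\<^sub>R v | s t. s \<in> {0..1} \<and> t \<in> {0..1}})"

definition has_side_ratio :: "real \<Rightarrow> complex set \<Rightarrow> bool" where
  "has_side_ratio r R \<longleftrightarrow> (\<exists>s>0. rectangle_with_sides s (r * s) R)"

definition congruent_sets :: "complex set \<Rightarrow> complex set \<Rightarrow> bool" where
  "congruent_sets A B \<longleftrightarrow>
     (\<exists>f :: complex \<Rightarrow> complex. (\<forall>x y. dist (f x) (f y) = dist x y) \<and> f ` A = B)"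

definition dissection :: "complex set set \<Rightarrow> complex set \<Rightarrow> bool" where
  "dissection D M \<longleftrightarrow> finite D \<and> (\<forall>R\<in>D. \<exists>l m. rectangle_with_sides l m R) \<and>
     \<Union>D = M \<and> pairwise (\<lambda>R S. interior R \<inter> interior S = {}) D"

definition dissectable_into_similar :: "complex set \<Rightarrow> real \<Rightarrow> bool" where
  "dissectable_into_similar M r \<longleftrightarrow> (\<exists>D. dissection D M \<and> (\<forall>R\<in>D. has_side_ratio r R))"

definition dissectable_into_equal :: "complex set \<Rightarrow> real \<Rightarrow> bool" where
  "dissectable_into_equal M r \<longleftrightarrow>
     (\<exists>D. dissection D M \<and> (\<forall>R\<in>D. has_side_ratio r R) \<and> (\<forall>R\<in>D. \<forall>S\<in>D. congruent_sets R S))"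

end

(* Let x = a + b sqrt p and x' = a - b sqrt p. A rectangle of side ratio y > 0 can be dissected into
   rectangles of side ratio x if and only if y = U x + V / x with rational U, V >= 0; grids of
   rectangles stacked on each other give "if", so it remains to find U and V when M is dissected both
   into equal rectangles of ratio y and into rectangles of ratio x.

   In the spirit of Dehn, let B be a symmetric biadditive form on the reals. Fix a direction e. The sum
   of B(width, height) over the tiles parallel to e is the same for all dissections of M: the union of
   these tiles does not depend on the dissection (up to edges), since along a generic line parallel to
   e it jumps exactly where M jumps. Hence B(t, x t) >= 0 for all t implies B(1, y) >= 0.

   Let tau be an additive map on the reals that extends the conjugation of Q[sqrt p] and satisfies
   tau(sqrt p t) = - sqrt p tau(t). For a, b nonzero, the two forms
     u v / x + tau(u) tau(v) / x' - (u tau(v) + tau(u) v) / a   and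
     x u v + x' tau(u) tau(v) - (x x' / a) (u tau(v) + tau(u) v)
   take on (t, x t) the values (t - tau t)^2 and (x t - x' tau t)^2, and on (1, U x + V / x) they take
   the values V (1/x - 1/x')^2 and U (x - x')^2. If y is not in Q[sqrt p], then tau(y) can be prescribed
   arbitrarily, which contradicts B(1, y) >= 0 for the first form. For a = 0 the forms
   u tau(v) + tau(u) v and its negative serve instead, for b = 0 the forms g(u) g(v). *)
theory Submission
  imports Defs
begin

section \<open>Rectangles in a rotated frame\<close>

text \<open>For a unit vector \<open>e\<close>, the vectors \<open>e\<close> and
  \<open>\<i> * e\<close> form an orthonormal frame and the two inner products are the coordinates
  in it. Rectangles of every orientation thus become products of intervals.\<close>

definition frame_box :: "complex \<Rightarrow> real \<Rightarrow> real \<Rightarrow> real \<Rightarrow> real \<Rightarrow> complex set" where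
  "frame_box e l r b t = {z. l \<le> e \<bullet> z \<and> e \<bullet> z \<le> r \<and> b \<le> (\<i> * e) \<bullet> z \<and> (\<i> * e) \<bullet> z \<le> t}"

lemma frame_norm: "norm e = 1 \<Longrightarrow> Re e * Re e + Im e * Im e = 1"
  by (metis cmod_power2 one_power2 power2_eq_square)

lemma frame_decomp:
  assumes "norm e = 1"
  shows "z = (e \<bullet> z) *\<^sub>R e + ((\<i> * e) \<bullet> z) *\<^sub>R (\<i> * e)"
proof -
  have n: "Re e * Re e + Im e * Im e = 1" using frame_norm[OF assms] .
  have "Re z = (Re e * Re e + Im e * Im e) * Re z" "Im z = (Re e * Re e + Im e * Im e) * Im z"
    using n by auto
  then show ?thesis
    by (auto simp: complex_eq_iff inner_complex_def algebra_simps)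
qed

lemma frame_eqI:
  assumes "norm e = 1" "e \<bullet> z = e \<bullet> w" "(\<i> * e) \<bullet> z = (\<i> * e) \<bullet> w"
  shows "z = w"
  using frame_decomp[OF assms(1), of z] frame_decomp[OF assms(1), of w] assms(2,3) by simp

lemma frame_inner:
  assumes "norm e = 1"
  shows "e \<bullet> (c *\<^sub>R e) = c" "(\<i> * e) \<bullet> (c *\<^sub>R e) = 0"
    "e \<bullet> (c *\<^sub>R (\<i> * e)) = 0" "(\<i> * e) \<bullet> (c *\<^sub>R (\<i> * e)) = c"
  using frame_norm[OF assms] by (auto simp: inner_complex_def algebra_simps)
    (metis distrib_left mult.right_neutral)+

lemma frame_box_eq_image:
  assumes "norm e = 1" "l > 0" "m > 0"
  shows "{z + s *\<^sub>R (l *\<^sub>R e) + t *\<^sub>R (m *\<^sub>R (\<i> * e)) | s t. s \<in> {0..1} \<and> t \<in> {0..1}}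
    = frame_box e (e \<bullet> z) (e \<bullet> z + l) ((\<i> * e) \<bullet> z) ((\<i> * e) \<bullet> z + m)" (is "?L = ?R")
proof
  show "?L \<subseteq> ?R"
    using assms by (auto simp: frame_box_def inner_add_right frame_inner
        simp del: inner_scaleR_right scaleR_scaleR
        simp add: scaleR_scaleR[of _ _ e] frame_inner scaleR_scaleR[of _ _ "\<i> * e"] mult_le_cancel_right1)
  show "?R \<subseteq> ?L"
  proof
    fix w assume w: "w \<in> ?R"
    define s where "s = (e \<bullet> w - e \<bullet> z) / l"
    define t where "t = ((\<i> * e) \<bullet> w - (\<i> * e) \<bullet> z) / m"
    have st: "s \<in> {0..1}" "t \<in> {0..1}"
      using w assms by (auto simp: frame_box_def s_def t_def divide_le_eq)
    have "w = z + s *\<^sub>R (l *\<^sub>R e) + t *\<^sub>R (m *\<^sub>R (\<i> * e))"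
      using assms by (intro frame_eqI[OF assms(1)])
        (auto simp: inner_add_right scaleR_scaleR frame_inner s_def t_def simp del: inner_scaleR_right)
    with st show "w \<in> ?L" by blast
  qed
qed

text \<open>Substitute \<open>1 - t\<close> for \<open>t\<close>. This turns a second side along
  \<open>- (\<i> * e)\<close> into one along \<open>\<i> * e\<close>.\<close>

lemma parallelogram_flip:
  fixes z u v :: complex
  shows "{z + s *\<^sub>R u + t *\<^sub>R v | s t. s \<in> {0..1::real} \<and> t \<in> {0..1::real}}
    = {(z + v) + s *\<^sub>R u + t *\<^sub>R (- v) | s t. s \<in> {0..1} \<and> t \<in> {0..1}}"
proof -
  have "\<exists>s' t'. z + s *\<^sub>R u + t *\<^sub>R v = (z + v) + s' *\<^sub>R u + t' *\<^sub>R (- v) \<and> s' \<in> {0..1} \<and> t' \<in> {0..1}"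
    "\<exists>s' t'. (z + v) + s *\<^sub>R u + t *\<^sub>R (- v) = z + s' *\<^sub>R u + t' *\<^sub>R v \<and> s' \<in> {0..1} \<and> t' \<in> {0..1}"
    if "s \<in> {0..1}" "t \<in> {0..1}" for s t :: real
    by (rule exI[of _ s], rule exI[of _ "1 - t"], use that in \<open>auto simp: algebra_simps\<close>)+
  then show ?thesis by blast
qed

text \<open>The second side is orthogonal to the first, hence a real multiple of
  \<open>\<i> * e\<close> with factor \<open>m\<close> or \<open>- m\<close>;
  \<open>parallelogram_flip\<close> removes the negative case.\<close>

lemma rectangle_iff_frame_box:
  "rectangle_with_sides l m R \<longleftrightarrow>
     l > 0 \<and> m > 0 \<and> (\<exists>e x y. norm e = 1 \<and> R = frame_box e x (x + l) y (y + m))"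
proof (intro iffI conjI; (elim conjE exE)?)
  assume R: "rectangle_with_sides l m R"
  then show pos: "l > 0" "m > 0" by (auto simp: rectangle_with_sides_def)
  from R obtain z u v where uv: "u \<bullet> v = 0" "norm u = l" "norm v = m"
    and Req: "R = {z + s *\<^sub>R u + t *\<^sub>R v | s t. s \<in> {0..1} \<and> t \<in> {0..1}}"
    by (auto simp: rectangle_with_sides_def)
  define e where "e = u /\<^sub>R l"
  have e: "norm e = 1" "u = l *\<^sub>R e" using uv pos by (auto simp: e_def)
  define k where "k = (\<i> * e) \<bullet> v"
  have v: "v = k *\<^sub>R (\<i> * e)"
    using frame_decomp[OF e(1), of v] uv(1) pos by (simp add: k_def e(2))
  then have "\<bar>k\<bar> = m" using uv(3) e(1) by (simp add: norm_mult)
  then consider "v = m *\<^sub>R (\<i> * e)" | "- v = m *\<^sub>R (\<i> * e)"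
    using v by (metis abs_if minus_minus scaleR_minus_left)
  then show "\<exists>e x y. norm e = 1 \<and> R = frame_box e x (x + l) y (y + m)"
  proof cases
    case 1
    then show ?thesis using frame_box_eq_image[OF e(1) pos, of z] e Req by auto
  next
    case 2
    have "R = {(z + v) + s *\<^sub>R u + t *\<^sub>R (- v) | s t. s \<in> {0..1} \<and> t \<in> {0..1}}"
      unfolding Req by (rule parallelogram_flip)
    then show ?thesis using frame_box_eq_image[OF e(1) pos, of "z + v"] e 2 by auto
  qed
next
  fix e x y assume pos: "l > 0" "m > 0" and e: "norm e = 1" and R: "R = frame_box e x (x + l) y (y + m)"
  let ?z = "x *\<^sub>R e + y *\<^sub>R (\<i> * e)"
  have "e \<bullet> ?z = x" "(\<i> * e) \<bullet> ?z = y"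
    using frame_inner[OF e] by (simp_all only: inner_add_right add_0_left add_0_right)
  then have "R = {?z + s *\<^sub>R (l *\<^sub>R e) + t *\<^sub>R (m *\<^sub>R (\<i> * e)) | s t. s \<in> {0..1} \<and> t \<in> {0..1}}"
    using frame_box_eq_image[OF e pos, of ?z] R by simp
  moreover have "(l *\<^sub>R e) \<bullet> (m *\<^sub>R (\<i> * e)) = 0" "norm (l *\<^sub>R e) = l" "norm (m *\<^sub>R (\<i> * e)) = m"
    using pos e by (auto simp: norm_mult inner_complex_def)
  ultimately show "rectangle_with_sides l m R"
    using pos unfolding rectangle_with_sides_def by blast
qed

lemma frame_box_halfspaces:
  "frame_box e l r b t =
     {z. e \<bullet> z \<ge> l} \<inter> {z. e \<bullet> z \<le> r} \<inter> {z. (\<i> * e) \<bullet> z \<ge> b} \<inter> {z. (\<i> * e) \<bullet> z \<le> t}"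
  by (auto simp: frame_box_def)

lemma interior_frame_box:
  assumes "e \<noteq> 0"
  shows "interior (frame_box e l r b t) =
    {z. l < e \<bullet> z \<and> e \<bullet> z < r \<and> b < (\<i> * e) \<bullet> z \<and> (\<i> * e) \<bullet> z < t}"
  unfolding frame_box_halfspaces using assms by (auto simp: interior_halfspace_le interior_halfspace_ge)

lemma closed_frame_box: "closed (frame_box e l r b t)"
  unfolding frame_box_halfspaces by (intro closed_Int closed_halfspace_le closed_halfspace_ge)

lemma convex_frame_box: "convex (frame_box e l r b t)"
  unfolding frame_box_halfspaces by (intro convex_Int convex_halfspace_le convex_halfspace_ge)

lemma closure_interior_frame_box:
  assumes "norm e = 1" "l < r" "b < t"
  shows "closure (interior (frame_box e l r b t)) = frame_box e l r b t"
proof -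
  have e: "e \<noteq> 0" using assms(1) by auto
  let ?z = "((l + r) / 2) *\<^sub>R e + ((b + t) / 2) *\<^sub>R (\<i> * e)"
  have "e \<bullet> ?z = (l + r) / 2" "(\<i> * e) \<bullet> ?z = (b + t) / 2"
    using frame_inner[OF assms(1)] by (simp_all only: inner_add_right add_0_left add_0_right)
  then have "?z \<in> interior (frame_box e l r b t)"
    using assms unfolding interior_frame_box[OF e] by auto
  then show ?thesis
    using convex_closure_interior[OF convex_frame_box] closed_frame_box by (metis closure_closed empty_iff)
qed

text \<open>Multiplication by \<open>\<alpha>\<close> is the rotation \<open>sgn \<alpha>\<close>
  together with scaling by \<open>norm \<alpha>\<close>, so coordinates in the rotated frame are the
  old ones times \<open>norm \<alpha>\<close>; adding \<open>\<beta>\<close> shifts them.\<close>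

lemma image_frame_box:
  assumes "\<alpha> \<noteq> 0"
  shows "(\<lambda>w. \<alpha> * w + \<beta>) ` frame_box e l r b t =
    frame_box (sgn \<alpha> * e) (norm \<alpha> * l + (sgn \<alpha> * e) \<bullet> \<beta>) (norm \<alpha> * r + (sgn \<alpha> * e) \<bullet> \<beta>)
      (norm \<alpha> * b + (\<i> * (sgn \<alpha> * e)) \<bullet> \<beta>) (norm \<alpha> * t + (\<i> * (sgn \<alpha> * e)) \<bullet> \<beta>)" (is "_ ` ?S = ?T")
proof -
  have n: "norm \<alpha> > 0" using assms by simp
  have key: "(sgn \<alpha> * d) \<bullet> (\<alpha> * w) = norm \<alpha> * (d \<bullet> w)" for d w
  proof -
    have "(Re \<alpha> * Re \<alpha> + Im \<alpha> * Im \<alpha>) = norm \<alpha> * norm \<alpha>"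
      by (metis cmod_power2 power2_eq_square)
    then have "(\<alpha> * d) \<bullet> (\<alpha> * w) = norm \<alpha> * norm \<alpha> * (d \<bullet> w)"
      by (simp flip: \<open>_ = norm \<alpha> * norm \<alpha>\<close> add: inner_complex_def algebra_simps)
    then show ?thesis using n by (simp add: sgn_div_norm divide_simps)
  qed
  have eq: "(sgn \<alpha> * e) \<bullet> (\<alpha> * w + \<beta>) = norm \<alpha> * (e \<bullet> w) + (sgn \<alpha> * e) \<bullet> \<beta>"
    "(\<i> * (sgn \<alpha> * e)) \<bullet> (\<alpha> * w + \<beta>) = norm \<alpha> * ((\<i> * e) \<bullet> w) + (\<i> * (sgn \<alpha> * e)) \<bullet> \<beta>" for w
    using key[of e w] key[of "\<i> * e" w] by (simp_all add: inner_add_right mult.left_commute)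
  have iff: "\<alpha> * w + \<beta> \<in> ?T \<longleftrightarrow> w \<in> ?S" for w
    using n unfolding frame_box_def mem_Collect_eq eq by simp
  show ?thesis
  proof (intro equalityI subsetI)
    fix v assume "v \<in> ?T"
    moreover have v: "v = \<alpha> * ((v - \<beta>) / \<alpha>) + \<beta>" using assms by simp
    ultimately have "(v - \<beta>) / \<alpha> \<in> ?S" using iff[of "(v - \<beta>) / \<alpha>"] by simp
    with v show "v \<in> (\<lambda>w. \<alpha> * w + \<beta>) ` ?S" by (rule image_eqI)
  qed (use iff in auto)
qed

section \<open>Composing dissections\<close>

lemma interior_affine_image:
  fixes \<alpha> \<beta> :: complex
  assumes "\<alpha> \<noteq> 0"
  shows "interior ((\<lambda>w. \<alpha> * w + \<beta>) ` S) = (\<lambda>w. \<alpha> * w + \<beta>) ` interior S"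
proof -
  have lin: "linear ((*) \<alpha>)" by (simp add: bounded_linear.linear bounded_linear_mult_right)
  have inj: "inj ((*) \<alpha>)" using assms by (auto simp: inj_on_def)
  have img: "(\<lambda>w. \<alpha> * w + \<beta>) ` T = (+) \<beta> ` ((*) \<alpha> ` T)" for T
    by (auto simp: image_image add.commute)
  show ?thesis
    unfolding img interior_translation interior_injective_linear_image[OF lin inj] ..
qed

lemma rectangle_affine_image:
  assumes "\<alpha> \<noteq> 0" "rectangle_with_sides l m R"
  shows "rectangle_with_sides (norm \<alpha> * l) (norm \<alpha> * m) ((\<lambda>w. \<alpha> * w + \<beta>) ` R)"
proof -
  from assms(2) obtain e x y where e: "norm e = 1" and R: "R = frame_box e x (x + l) y (y + m)"
    and "l > 0" "m > 0"
    unfolding rectangle_iff_frame_box by blast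
  moreover have "norm (sgn \<alpha> * e) = 1" using e assms(1) by (simp add: norm_mult norm_sgn)
  ultimately show ?thesis
    unfolding rectangle_iff_frame_box R image_frame_box[OF assms(1)] using assms(1)
    by (intro conjI exI[of _ "sgn \<alpha> * e"]
        exI[of _ "norm \<alpha> * x + (sgn \<alpha> * e) \<bullet> \<beta>"] exI[of _ "norm \<alpha> * y + (\<i> * (sgn \<alpha> * e)) \<bullet> \<beta>"])
       (auto simp: algebra_simps)
qed

lemma has_side_ratio_affine_image:
  assumes "\<alpha> \<noteq> 0" "has_side_ratio r R"
  shows "has_side_ratio r ((\<lambda>w. \<alpha> * w + \<beta>) ` R)"
proof -
  from assms(2) obtain s where "s > 0" "rectangle_with_sides s (r * s) R"
    by (auto simp: has_side_ratio_def)
  then show ?thesis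
    using rectangle_affine_image[OF assms(1), of s "r * s" R] assms(1)
    unfolding has_side_ratio_def by (intro exI[of _ "norm \<alpha> * s"]) (auto simp: mult.left_commute)
qed

lemma dissectable_into_similar_affine_image:
  assumes "\<alpha> \<noteq> 0" "dissectable_into_similar M r"
  shows "dissectable_into_similar ((\<lambda>w. \<alpha> * w + \<beta>) ` M) r"
proof -
  let ?f = "\<lambda>w. \<alpha> * w + \<beta>"
  from assms(2) obtain D where D: "dissection D M" "\<forall>R\<in>D. has_side_ratio r R"
    by (auto simp: dissectable_into_similar_def)
  have inj: "inj ?f" using assms(1) by (auto simp: inj_on_def)
  have "interior (?f ` R) \<inter> interior (?f ` S) = {}" if "R \<in> D" "S \<in> D" "?f ` R \<noteq> ?f ` S" for R S
  proof -
    have "interior R \<inter> interior S = {}"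
      using D(1) that unfolding dissection_def pairwise_def by blast
    then show ?thesis
      unfolding interior_affine_image[OF assms(1)] by (simp flip: image_Int[OF inj])
  qed
  then have "pairwise (\<lambda>R S. interior R \<inter> interior S = {}) ((`) ?f ` D)"
    by (auto simp: pairwise_def)
  moreover have "\<exists>l m. rectangle_with_sides l m (?f ` R)" if "R \<in> D" for R
    using D(1) that rectangle_affine_image[OF assms(1)] unfolding dissection_def by blast
  ultimately have "dissection ((`) ?f ` D) (?f ` M)"
    using D(1) unfolding dissection_def by (auto simp: image_Union)
  then show ?thesis
    unfolding dissectable_into_similar_def
    using D(2) has_side_ratio_affine_image[OF assms(1)] by blast
qed

text \<open>One dissection is chosen for each member and all tiles are pooled. Tiles from different
  members cannot overlap, since their interiors lie in the disjoint interiors of those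
  members.\<close>

lemma dissectable_into_similar_Union:
  assumes "finite F" "\<And>A. A \<in> F \<Longrightarrow> dissectable_into_similar A r"
    and disj: "pairwise (\<lambda>A B. interior A \<inter> interior B = {}) F"
  shows "dissectable_into_similar (\<Union>F) r"
proof -
  have "\<exists>D. \<forall>A\<in>F. dissection (D A) A \<and> (\<forall>R\<in>D A. has_side_ratio r R)"
    using assms(2) unfolding dissectable_into_similar_def by (intro bchoice) blast
  then obtain D where D: "\<And>A. A \<in> F \<Longrightarrow> dissection (D A) A"
    and ratio: "\<And>A R. A \<in> F \<Longrightarrow> R \<in> D A \<Longrightarrow> has_side_ratio r R"
    by blast
  have disj': "interior R \<inter> interior S = {}"
    if "A \<in> F" "R \<in> D A" "B \<in> F" "S \<in> D B" "R \<noteq> S" for A B R S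
  proof (cases "A = B")
    case True
    with D that show ?thesis unfolding dissection_def pairwise_def by blast
  next
    case False
    have "R \<subseteq> A" "S \<subseteq> B" using D that unfolding dissection_def by blast+
    then have "interior R \<subseteq> interior A" "interior S \<subseteq> interior B" by (simp_all add: interior_mono)
    moreover have "interior A \<inter> interior B = {}"
      using disj False that(1,3) by (simp add: pairwise_def)
    ultimately show ?thesis by blast
  qed
  have "pairwise (\<lambda>R S. interior R \<inter> interior S = {}) (\<Union>(D ` F))"
  proof (rule pairwiseI)
    fix R S assume "R \<in> \<Union>(D ` F)" "S \<in> \<Union>(D ` F)" and neq: "R \<noteq> S"
    then obtain A B where "A \<in> F" "R \<in> D A" "B \<in> F" "S \<in> D B" by auto
    with neq show "interior R \<inter> interior S = {}" by (intro disj')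
  qed
  moreover have "\<Union>(\<Union>(D ` F)) = \<Union>F"
  proof -
    have "\<Union>(D A) = A" if "A \<in> F" for A using D[OF that] by (simp add: dissection_def)
    then have "(\<Union>A\<in>F. \<Union>(D A)) = \<Union>F" by simp
    moreover have "\<Union>(\<Union>(D ` F)) = (\<Union>A\<in>F. \<Union>(D A))" by blast
    ultimately show ?thesis by simp
  qed
  ultimately have "dissection (\<Union>(D ` F)) (\<Union>F)"
    using D assms(1) unfolding dissection_def by simp
  then show ?thesis
    unfolding dissectable_into_similar_def using ratio by blast
qed

lemma frame_box_cong:
  "l = l' \<Longrightarrow> r = r' \<Longrightarrow> b = b' \<Longrightarrow> t = t' \<Longrightarrow> frame_box e l r b t = frame_box e l' r' b' t'"
  by simp

text \<open>Rotate the frame of \<open>R\<close> onto that of \<open>S\<close>, scale the first side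
  to the right length and move corner to corner; equality of the ratios takes care of the second
  side.\<close>

lemma same_ratio_affine_image:
  assumes "has_side_ratio y R" "has_side_ratio y S"
  obtains \<alpha> \<beta> where "\<alpha> \<noteq> 0" "S = (\<lambda>w. \<alpha> * w + \<beta>) ` R"
proof -
  obtain s e x c where s: "s > 0" and e: "norm e = 1" and R: "R = frame_box e x (x + s) c (c + y * s)"
    using assms(1) unfolding has_side_ratio_def rectangle_iff_frame_box by blast
  obtain s' e' x' c' where s': "s' > 0" and e': "norm e' = 1"
    and S: "S = frame_box e' x' (x' + s') c' (c' + y * s')"
    using assms(2) unfolding has_side_ratio_def rectangle_iff_frame_box by blast
  define \<alpha> where "\<alpha> = of_real (s' / s) * (e' / e)"
  \<comment> \<open>In the frame \<open>e'\<close>, this is the shift from the rotated and scaled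
    corner of \<open>R\<close> to the corner \<open>(x', c')\<close> of \<open>S\<close>.\<close>
  define \<beta> where "\<beta> = (x' - s' / s * x) *\<^sub>R e' + (c' - s' / s * c) *\<^sub>R (\<i> * e')"
  have e0: "e \<noteq> 0" "e' \<noteq> 0" using e e' by auto
  have n: "norm \<alpha> = s' / s" using s s' e e' by (simp add: \<alpha>_def norm_mult norm_divide)
  have a0: "\<alpha> \<noteq> 0" using s s' e0 by (simp add: \<alpha>_def)
  have "sgn \<alpha> = e' / e"
    unfolding sgn_div_norm n using s s' by (simp add: \<alpha>_def scaleR_conv_of_real)
  then have sg: "sgn \<alpha> * e = e'" using e0 by simp
  have ip: "e' \<bullet> \<beta> = x' - s' / s * x" "(\<i> * e') \<bullet> \<beta> = c' - s' / s * c"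
    unfolding \<beta>_def inner_add_right frame_inner[OF e'] by simp_all
  have "S = (\<lambda>w. \<alpha> * w + \<beta>) ` R"
    unfolding R S image_frame_box[OF a0] sg n ip using s
    by (intro frame_box_cong) (simp_all add: field_simps)
  with a0 show thesis by (rule that)
qed

text \<open>Each tile of \<open>D\<close> is a similar copy of \<open>R\<close> and inherits its
  dissection. This gives the backward half of the equivalence.\<close>

lemma dissectable_refine:
  assumes D: "dissection D M" "\<forall>S\<in>D. has_side_ratio y S"
    and R: "has_side_ratio y R" "dissectable_into_similar R r"
  shows "dissectable_into_similar M r"
proof -
  have "dissectable_into_similar S r" if "S \<in> D" for S
    using same_ratio_affine_image[OF R(1)] dissectable_into_similar_affine_image[OF _ R(2)] D(2) that
    by metis
  then have "dissectable_into_similar (\<Union>D) r"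
    using D(1) by (intro dissectable_into_similar_Union) (auto simp: dissection_def)
  then show ?thesis using D(1) by (simp add: dissection_def)
qed

section \<open>Grids of axis-parallel tiles\<close>

text \<open>All positions are quantified over, so that boxes can be put side by side without moving
  dissections around.\<close>

definition box_dissectable :: "real \<Rightarrow> real \<Rightarrow> real \<Rightarrow> bool" where
  "box_dissectable r w h \<longleftrightarrow> (\<forall>x y. dissectable_into_similar (frame_box 1 x (x + w) y (y + h)) r)"

lemma dissectable_into_similar_self:
  assumes "has_side_ratio r R"
  shows "dissectable_into_similar R r"
  unfolding dissectable_into_similar_def dissection_def
  using assms by (intro exI[of _ "{R}"]) (auto simp: has_side_ratio_def)

lemma rectangle_swap: "rectangle_with_sides l m R \<Longrightarrow> rectangle_with_sides m l R"
proof -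
  have swap: "{z + s *\<^sub>R u + t *\<^sub>R v | s t. s \<in> {0..1::real} \<and> t \<in> {0..1::real}}
    = {z + s *\<^sub>R v + t *\<^sub>R u | s t. s \<in> {0..1} \<and> t \<in> {0..1}}" for z u v :: complex
    by (force simp: add_ac)
  show "rectangle_with_sides l m R \<Longrightarrow> rectangle_with_sides m l R"
    unfolding rectangle_with_sides_def by (metis (no_types, lifting) swap inner_commute)
qed

lemma rectangle_frame_box:
  "norm e = 1 \<Longrightarrow> l > 0 \<Longrightarrow> m > 0 \<Longrightarrow> rectangle_with_sides l m (frame_box e x (x + l) y (y + m))"
  unfolding rectangle_iff_frame_box by blast

lemma box_dissectable_single:
  assumes "r > 0" "s > 0"
  shows "box_dissectable r s (r * s)" "box_dissectable r (r * s) s"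
proof -
  have "rectangle_with_sides s (r * s) (frame_box 1 x (x + s) y (y + r * s))"
    "rectangle_with_sides (r * s) s (frame_box 1 x (x + r * s) y (y + s))" for x y
    using assms by (auto intro: rectangle_frame_box)
  then have "has_side_ratio r (frame_box 1 x (x + s) y (y + r * s))"
    "has_side_ratio r (frame_box 1 x (x + r * s) y (y + s))" for x y
    using assms(2) rectangle_swap unfolding has_side_ratio_def by blast+
  then show "box_dissectable r s (r * s)" "box_dissectable r (r * s) s"
    unfolding box_dissectable_def by (auto intro!: dissectable_into_similar_self)
qed

lemma dissectable_into_similar_Un:
  assumes "dissectable_into_similar A r" "dissectable_into_similar B r" "interior A \<inter> interior B = {}"
  shows "dissectable_into_similar (A \<union> B) r"
  using dissectable_into_similar_Union[of "{A, B}" r] assms by (auto simp: pairwise_def)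

lemma box_dissectable_add:
  assumes "w > 0" "h > 0"
  shows "box_dissectable r w h \<Longrightarrow> w' > 0 \<Longrightarrow> box_dissectable r w' h \<Longrightarrow> box_dissectable r (w + w') h"
    and "box_dissectable r w h \<Longrightarrow> h' > 0 \<Longrightarrow> box_dissectable r w h' \<Longrightarrow> box_dissectable r w (h + h')"
proof -
  assume *: "box_dissectable r w h" "w' > 0" "box_dissectable r w' h"
  have "frame_box 1 x (x + (w + w')) y (y + h) =
    frame_box 1 x (x + w) y (y + h) \<union> frame_box 1 (x + w) (x + w + w') y (y + h)" for x y
    using assms *(2) by (auto simp: frame_box_def)
  then show "box_dissectable r (w + w') h"
    using * unfolding box_dissectable_def
    by (auto intro!: dissectable_into_similar_Un simp: interior_frame_box)
next
  assume *: "box_dissectable r w h" "h' > 0" "box_dissectable r w h'"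
  have "frame_box 1 x (x + w) y (y + (h + h')) =
    frame_box 1 x (x + w) y (y + h) \<union> frame_box 1 x (x + w) (y + h) (y + h + h')" for x y
    using assms *(2) by (auto simp: frame_box_def)
  then show "box_dissectable r w (h + h')"
    using * unfolding box_dissectable_def
    by (auto intro!: dissectable_into_similar_Un simp: interior_frame_box)
qed

lemma box_dissectable_grid:
  assumes "box_dissectable r w h" "w > 0" "h > 0" "m > 0" "n > 0"
  shows "box_dissectable r (real m * w) (real n * h)"
proof -
  have row: "box_dissectable r (real m * w) h" using assms(4)
  proof (induction m rule: nat_induct_non_zero)
    case (Suc m)
    then show ?case
      using box_dissectable_add(1)[of "real m * w" h r w] assms by (simp add: algebra_simps)
  qed (use assms(1) in simp)
  show ?thesis using assms(5)
  proof (induction n rule: nat_induct_non_zero)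
    case (Suc n)
    then show ?case
      using box_dissectable_add(2)[of "real m * w" "real n * h" r h] row assms
      by (simp add: algebra_simps)
  qed (use row in simp)
qed

lemma nonneg_rats_common_denominator:
  assumes "U \<in> \<rat>" "V \<in> \<rat>" "U \<ge> 0" "V \<ge> (0::real)"
  obtains m k n :: nat where "n > 0" "U = real m / real n" "V = real k / real n"
proof -
  obtain m n where mn: "n \<noteq> 0" "U = real m / real n"
    using Rats_abs_nat_div_natE[OF assms(1)] assms(3) by (metis abs_of_nonneg)
  obtain m' n' where mn': "n' \<noteq> 0" "V = real m' / real n'"
    using Rats_abs_nat_div_natE[OF assms(2)] assms(4) by (metis abs_of_nonneg)
  show thesis
    by (rule that[of "n * n'" "m * n'" "m' * n"]) (use mn mn' in \<open>auto simp: field_simps\<close>)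
qed

text \<open>Take a \<open>1\<close> by \<open>y\<close> rectangle and write
  \<open>U = m / n\<close>, \<open>V = k / n\<close>. A strip of height \<open>U * x\<close>
  consists of \<open>m\<close> rows of \<open>n\<close> tiles of width \<open>1 / n\<close> and
  height \<open>x / n\<close>; a strip of height \<open>V / x\<close> consists of \<open>k\<close>
  rows of \<open>n\<close> tiles of width \<open>1 / n\<close> and height
  \<open>1 / (x * n)\<close>.\<close>

lemma dissectable_rectangle_of_ratio:
  assumes x: "x > 0" and UV: "U \<in> \<rat>" "V \<in> \<rat>" "U \<ge> 0" "V \<ge> 0"
    and y: "y = U * x + V / x" "y > 0"
  shows "\<exists>R. has_side_ratio y R \<and> dissectable_into_similar R x"
proof -
  obtain m k n :: nat where n: "n > 0" and U: "U = real m / real n" and V: "V = real k / real n"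
    by (rule nonneg_rats_common_denominator[OF UV])
  have A: "box_dissectable x 1 (U * x)" if "m > 0"
  proof -
    have "box_dissectable x (1 / real n) (x * (1 / real n))"
      using x n by (intro box_dissectable_single) auto
    from box_dissectable_grid[OF this _ _ n that] show ?thesis
      using x n by (simp add: U field_simps)
  qed
  have B: "box_dissectable x 1 (V / x)" if "k > 0"
  proof -
    have "box_dissectable x (x * (1 / (x * real n))) (1 / (x * real n))"
      using x n by (intro box_dissectable_single) auto
    from box_dissectable_grid[OF this _ _ n that] show ?thesis
      using x n by (simp add: V field_simps)
  qed
  have "box_dissectable x 1 y"
  \<comment> \<open>A strip of height zero is left out; by \<open>y > 0\<close> the two heights do
    not both vanish.\<close>
  proof (cases "m = 0 \<or> k = 0")
    case True
    then have "m > 0 \<and> y = U * x \<or> k > 0 \<and> y = V / x" using y U V by (cases "m = 0"; cases "k = 0") auto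
    then show ?thesis using A B by auto
  next
    case False
    then have "U * x > 0" "V / x > 0" using x U V n by auto
    then show ?thesis using A B y False by (auto intro!: box_dissectable_add(2))
  qed
  moreover have "has_side_ratio y (frame_box 1 0 (0 + 1) 0 (0 + y))"
    unfolding has_side_ratio_def using rectangle_frame_box[of 1 1 y 0 0] y(2)
    by (intro exI[of _ 1]) simp
  ultimately show ?thesis unfolding box_dissectable_def by blast
qed

section \<open>Tiles parallel to a given frame\<close>

abbreviation frame_point :: "complex \<Rightarrow> real \<Rightarrow> real \<Rightarrow> complex" where
  "frame_point e x y \<equiv> x *\<^sub>R e + y *\<^sub>R (\<i> * e)"

text \<open>The part \<open>P\<close> of a dissection \<open>D\<close> into boxes parallel to the frame \<open>e\<close>, \<open>\<i> * e\<close>. The two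
  inner products in the last clause say that no side of a remaining tile is parallel to \<open>e\<close>.\<close>
definition aligned_part :: "complex \<Rightarrow> complex set set \<Rightarrow> complex set set \<Rightarrow> bool" where
  "aligned_part e D P \<longleftrightarrow> P \<subseteq> D \<and>
     (\<forall>R\<in>P. \<exists>l r b t. l < r \<and> b < t \<and> R = frame_box e l r b t) \<and>
     (\<forall>R\<in>D - P. \<exists>d l r b t. norm d = 1 \<and> d \<bullet> (\<i> * e) \<noteq> 0 \<and> (\<i> * d) \<bullet> (\<i> * e) \<noteq> 0 \<and>
        l < r \<and> b < t \<and> R = frame_box d l r b t)"

lemma aligned_partD:
  assumes "aligned_part e D P"
  shows "P \<subseteq> D" "R \<in> P \<Longrightarrow> \<exists>l r b t. l < r \<and> b < t \<and> R = frame_box e l r b t"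
    "R \<in> D - P \<Longrightarrow> \<exists>d l r b t. norm d = 1 \<and> d \<bullet> (\<i> * e) \<noteq> 0 \<and> (\<i> * d) \<bullet> (\<i> * e) \<noteq> 0 \<and>
        l < r \<and> b < t \<and> R = frame_box d l r b t"
  using assms unfolding aligned_part_def by simp_all

lemma frame_point_inner:
  assumes "norm e = 1"
  shows "e \<bullet> frame_point e x y = x" "(\<i> * e) \<bullet> frame_point e x y = y"
  unfolding inner_add_right frame_inner[OF assms] by simp_all

text \<open>The two inner products are sine and cosine of the angle between the frames, up to sign.
  If one of them vanishes, then \<open>d\<close> is a multiple of \<open>e\<close> or of
  \<open>\<i> * e\<close>, with a factor of modulus 1.\<close>

lemma frame_cases:
  assumes "norm e = 1" "norm d = 1"
  obtains "d \<bullet> (\<i> * e) \<noteq> 0" "(\<i> * d) \<bullet> (\<i> * e) \<noteq> 0" | "d = e" | "d = - e" | "d = \<i> * e" | "d = - (\<i> * e)"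
proof -
  have d: "d = (e \<bullet> d) *\<^sub>R e + ((\<i> * e) \<bullet> d) *\<^sub>R (\<i> * e)" using frame_decomp[OF assms(1)] .
  have i: "(\<i> * d) \<bullet> (\<i> * e) = e \<bullet> d" by (simp add: inner_complex_def)
  consider "d \<bullet> (\<i> * e) \<noteq> 0 \<and> (\<i> * d) \<bullet> (\<i> * e) \<noteq> 0" | "d = (e \<bullet> d) *\<^sub>R e" | "d = ((\<i> * e) \<bullet> d) *\<^sub>R (\<i> * e)"
  proof (cases "(\<i> * e) \<bullet> d = 0 \<or> e \<bullet> d = 0")
    case True
    then have "d = (e \<bullet> d) *\<^sub>R e \<or> d = ((\<i> * e) \<bullet> d) *\<^sub>R (\<i> * e)"
    proof
      assume "(\<i> * e) \<bullet> d = 0"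
      with d show ?thesis by simp
    next
      assume "e \<bullet> d = 0"
      with d show ?thesis by simp
    qed
    then show ?thesis using that by blast
  qed (use that i in \<open>simp add: inner_commute\<close>)
  then show thesis
  proof cases
    case 2
    then have "\<bar>e \<bullet> d\<bar> = 1" using assms by (metis mult.right_neutral norm_scaleR)
    then consider "e \<bullet> d = 1" | "e \<bullet> d = - 1" by linarith
    then show thesis using 2 that(2,3) by cases simp_all
  next
    case 3
    then have "\<bar>(\<i> * e) \<bullet> d\<bar> = 1" using assms by (metis mult.right_neutral norm_ii norm_mult norm_scaleR)
    then consider "(\<i> * e) \<bullet> d = 1" | "(\<i> * e) \<bullet> d = - 1" by linarith
    then show thesis using 3 that(4,5) by cases simp_all
  qed (use that in blast)
qed

text \<open>Used to read a tile whose frame differs from \<open>e\<close> by quarter turns as a box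
  of the frame \<open>e\<close>.\<close>

lemma frame_box_rotate:
  "frame_box (- e) l r b t = frame_box e (- r) (- l) (- t) (- b)"
  "frame_box (\<i> * e) l r b t = frame_box e (- t) (- b) l r"
  "frame_box (- (\<i> * e)) l r b t = frame_box e b t (- r) (- l)"
  by (auto simp: frame_box_def inner_complex_def)

lemma frontier_frame_box:
  assumes "norm e = 1" "z \<in> frontier (frame_box e l r b t)"
  shows "e \<bullet> z \<in> {l, r} \<or> (\<i> * e) \<bullet> z \<in> {b, t}"
proof -
  have e: "e \<noteq> 0" using assms(1) by auto
  have "z \<in> frame_box e l r b t" "z \<notin> interior (frame_box e l r b t)"
    using assms(2) closed_frame_box[of e l r b t] by (simp_all add: frontier_def)
  then show ?thesis
    unfolding interior_frame_box[OF e] by (auto simp: frame_box_def)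
qed

text \<open>None of the four side lines of the tilted box is parallel to the line with first
  coordinate \<open>x\<close>, so each meets it in one point.\<close>

lemma finite_frontier_line:
  assumes "norm d = 1" "d \<bullet> (\<i> * e) \<noteq> 0" "(\<i> * d) \<bullet> (\<i> * e) \<noteq> 0"
  shows "finite {y. frame_point e x y \<in> frontier (frame_box d l r b t)}"
proof (rule finite_subset)
  \<comment> \<open>The height \<open>y\<close> at which that line meets the side line
    \<open>a \<bullet> z = c\<close>.\<close>
  let ?g = "\<lambda>a c. (c - x * (a \<bullet> e)) / (a \<bullet> (\<i> * e))"
  show "{y. frame_point e x y \<in> frontier (frame_box d l r b t)}
    \<subseteq> {?g d l, ?g d r, ?g (\<i> * d) b, ?g (\<i> * d) t}"
  proof
    fix y assume "y \<in> {y. frame_point e x y \<in> frontier (frame_box d l r b t)}"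
    then have "d \<bullet> frame_point e x y \<in> {l, r} \<or> (\<i> * d) \<bullet> frame_point e x y \<in> {b, t}"
      using frontier_frame_box[OF assms(1)] by blast
    moreover have "y = ?g a c" if "a \<bullet> frame_point e x y = c" "a \<bullet> (\<i> * e) \<noteq> 0" for a c
      using that by (auto simp: inner_add_right field_simps)
    ultimately show "y \<in> {?g d l, ?g d r, ?g (\<i> * d) b, ?g (\<i> * d) t}"
      using assms(2,3) by (metis insert_iff singletonD)
  qed
qed simp

section \<open>The region covered by the aligned tiles is determined by the dissected set\<close>

lemma locally_constant_membership:
  assumes "finite F" "\<And>R. R \<in> F \<Longrightarrow> closed R" "\<And>R. R \<in> F \<Longrightarrow> q \<notin> frontier R"
  shows "\<exists>V. open V \<and> q \<in> V \<and> (\<forall>z\<in>V. \<forall>R\<in>F. z \<in> R \<longleftrightarrow> q \<in> R)"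
proof -
  let ?V = "\<Inter>R\<in>F. if q \<in> R then interior R else - R"
  have "open ?V" using assms(1,2) by (intro open_INT) auto
  moreover have "q \<in> ?V" using assms(2,3) by (auto simp: frontier_def)
  moreover have "z \<in> R \<longleftrightarrow> q \<in> R" if "z \<in> ?V" "R \<in> F" for z R
  proof -
    have "z \<in> (if q \<in> R then interior R else - R)" using that by blast
    then show ?thesis using interior_subset by (auto split: if_splits)
  qed
  ultimately show ?thesis by (intro exI[of _ ?V]) blast
qed

text \<open>If \<open>q\<close> lies in a tilted tile, it lies in its interior, where there are no
  aligned tiles. Otherwise the closed tilted tiles stay away from \<open>q\<close>, and near
  \<open>q\<close> only aligned tiles make up \<open>M\<close>.\<close>

lemma aligned_part_local:
  assumes "dissection D M" "aligned_part e D P" "norm e = 1" "\<And>S. S \<in> D - P \<Longrightarrow> q \<notin> frontier S"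
  shows "\<exists>U. open U \<and> q \<in> U \<and> (U \<subseteq> M \<and> U \<inter> \<Union>P = {} \<or> M \<inter> U = \<Union>P \<inter> U)"
proof (cases "q \<in> \<Union>(D - P)")
  case True
  then obtain S where S: "S \<in> D" "S \<notin> P" "q \<in> S" by blast
  \<comment> \<open>All of \<open>R\<close> is avoided, not just its interior: an open set that
    misses \<open>interior R\<close> also misses its closure, which is \<open>R\<close>.\<close>
  have "interior S \<inter> R = {}" if R: "R \<in> P" for R
  proof -
    obtain l r b t where "l < r" "b < t" "R = frame_box e l r b t"
      using aligned_partD(2)[OF assms(2) R] by auto
    then have "closure (interior R) = R" using closure_interior_frame_box[OF assms(3)] by blast
    moreover have "R \<in> D" "R \<noteq> S" using assms(2) R S by (auto simp: aligned_part_def)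
    then have "interior S \<inter> interior R = {}"
      using assms(1) S(1) unfolding dissection_def pairwise_def by blast
    then have "interior S \<inter> closure (interior R) = {}"
      by (simp add: open_Int_closure_eq_empty)
    ultimately show ?thesis by simp
  qed
  then have "interior S \<inter> \<Union>P = {}" by blast
  moreover have "interior S \<subseteq> M"
    using assms(1) S(1) interior_subset unfolding dissection_def by blast
  moreover have "q \<in> interior S"
    using assms(4)[of S] S closure_subset[of S] by (auto simp: frontier_def)
  ultimately show ?thesis by (intro exI[of _ "interior S"]) auto
next
  case False
  have "closed S" if "S \<in> D - P" for S
    using aligned_partD(3)[OF assms(2) that] closed_frame_box by auto
  then have "closed (\<Union>(D - P))"
    using assms(1) by (intro closed_Union) (auto simp: dissection_def)
  moreover have "M = \<Union>P \<union> \<Union>(D - P)"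
    using assms(1,2) by (auto simp: dissection_def aligned_part_def)
  ultimately show ?thesis using False by (intro exI[of _ "- \<Union>(D - P)"]) auto
qed

text \<open>The bounds of a box are recovered from the box as a set, so that sums over tiles need no
  choice of parameters. Passing \<open>\<i> * e\<close> instead of \<open>e\<close> gives the bounds
  in the second coordinate.\<close>

definition frame_lo :: "complex \<Rightarrow> complex set \<Rightarrow> real" where
  "frame_lo e R = Inf ((\<bullet>) e ` R)"

definition frame_hi :: "complex \<Rightarrow> complex set \<Rightarrow> real" where
  "frame_hi e R = Sup ((\<bullet>) e ` R)"

lemma frame_lo_hi:
  assumes "norm e = 1" "l < r" "b < t"
  shows "frame_lo e (frame_box e l r b t) = l" "frame_hi e (frame_box e l r b t) = r"
    "frame_lo (\<i> * e) (frame_box e l r b t) = b" "frame_hi (\<i> * e) (frame_box e l r b t) = t"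
proof -
  have 1: "(\<bullet>) e ` frame_box e l r b t = {l..r}"
  proof (intro equalityI subsetI)
    fix x assume "x \<in> {l..r}"
    then have "frame_point e x b \<in> frame_box e l r b t"
      unfolding frame_box_def mem_Collect_eq frame_point_inner[OF assms(1)] using assms by auto
    then show "x \<in> (\<bullet>) e ` frame_box e l r b t"
      using frame_point_inner(1)[OF assms(1)] by (metis image_eqI)
  qed (auto simp: frame_box_def)
  have 2: "(\<bullet>) (\<i> * e) ` frame_box e l r b t = {b..t}"
  proof (intro equalityI subsetI)
    fix y assume "y \<in> {b..t}"
    then have "frame_point e l y \<in> frame_box e l r b t"
      unfolding frame_box_def mem_Collect_eq frame_point_inner[OF assms(1)] using assms by auto
    then show "y \<in> (\<bullet>) (\<i> * e) ` frame_box e l r b t"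
      using frame_point_inner(2)[OF assms(1)] by (metis image_eqI)
  qed (auto simp: frame_box_def)
  show "frame_lo e (frame_box e l r b t) = l" "frame_hi e (frame_box e l r b t) = r"
    "frame_lo (\<i> * e) (frame_box e l r b t) = b" "frame_hi (\<i> * e) (frame_box e l r b t) = t"
    unfolding frame_lo_def frame_hi_def 1 2 using assms by auto
qed

lemma aligned_part_box:
  assumes "aligned_part e D P" "norm e = 1" "R \<in> P"
  shows "R = frame_box e (frame_lo e R) (frame_hi e R) (frame_lo (\<i> * e) R) (frame_hi (\<i> * e) R)"
    and "frame_lo e R < frame_hi e R" "frame_lo (\<i> * e) R < frame_hi (\<i> * e) R"
proof -
  obtain l r b t where *: "l < r" "b < t" "R = frame_box e l r b t"
    using aligned_partD(2)[OF assms(1,3)] by auto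
  from *(1,2) show "R = frame_box e (frame_lo e R) (frame_hi e R) (frame_lo (\<i> * e) R) (frame_hi (\<i> * e) R)"
    "frame_lo e R < frame_hi e R" "frame_lo (\<i> * e) R < frame_hi (\<i> * e) R"
    unfolding *(3) frame_lo_hi[OF assms(2) *(1,2)] by auto
qed

lemma aligned_unions_agree_on_line:
  assumes D: "dissection D M" "aligned_part e D P" and D': "dissection D' M" "aligned_part e D' P'"
    and e: "norm e = 1"
    and y1: "\<And>R. R \<in> P \<union> P' \<Longrightarrow> y \<notin> {frame_lo (\<i> * e) R, frame_hi (\<i> * e) R}"
    and y2: "\<And>R S x. R \<in> P \<union> P' \<Longrightarrow> S \<in> (D - P) \<union> (D' - P') \<Longrightarrow> x \<in> {frame_lo e R, frame_hi e R}
      \<Longrightarrow> frame_point e x y \<notin> frontier S"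
  shows "frame_point e x y \<in> \<Union>P \<longleftrightarrow> frame_point e x y \<in> \<Union>P'"
proof -
  \<comment> \<open>\<open>\<psi>\<close> is locally constant on the line: at the edges of aligned tiles by
    \<open>aligned_part_local\<close> (there are no tilted edges there), elsewhere because the aligned tiles
    have no edges there. Far to the left \<open>\<psi>\<close> is true.\<close>
  define \<psi> where "\<psi> z \<longleftrightarrow> (z \<in> \<Union>P \<longleftrightarrow> z \<in> \<Union>P')" for z
  have fin: "finite (P \<union> P')"
    using D D' by (auto simp: dissection_def aligned_part_def intro: finite_subset)
  have clo: "closed R" if "R \<in> P \<union> P'" for R
    using that aligned_partD(2)[OF D(2), of R] aligned_partD(2)[OF D'(2), of R] closed_frame_box by auto
  have nbhd: "\<exists>V. open V \<and> frame_point e u y \<in> V \<and> (\<forall>z\<in>V. \<psi> z = \<psi> (frame_point e u y))" for u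
  proof (cases "\<forall>R\<in>P \<union> P'. frame_point e u y \<notin> frontier R")
    case True
    then obtain V where "open V" "frame_point e u y \<in> V"
      "\<forall>z\<in>V. \<forall>R\<in>P \<union> P'. z \<in> R \<longleftrightarrow> frame_point e u y \<in> R"
      using locally_constant_membership[OF fin clo] by meson
    then show ?thesis unfolding \<psi>_def by (intro exI[of _ V]) blast
  next
    case False
    then obtain R where R: "R \<in> P \<union> P'" "frame_point e u y \<in> frontier R" by blast
    have "R = frame_box e (frame_lo e R) (frame_hi e R) (frame_lo (\<i> * e) R) (frame_hi (\<i> * e) R)"
      using R(1) aligned_part_box(1)[OF D(2) e] aligned_part_box(1)[OF D'(2) e] by blast
    then have "u \<in> {frame_lo e R, frame_hi e R}"
      using frontier_frame_box[OF e, of "frame_point e u y"] R y1[OF R(1)]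
      unfolding frame_point_inner[OF e] by metis
    then have off: "frame_point e u y \<notin> frontier S" if "S \<in> (D - P) \<union> (D' - P')" for S
      using y2[OF R(1) that] by blast
    obtain U where U: "open U" "frame_point e u y \<in> U" "U \<subseteq> M \<and> U \<inter> \<Union>P = {} \<or> M \<inter> U = \<Union>P \<inter> U"
      using aligned_part_local[OF D e, of "frame_point e u y"] off by auto
    obtain U' where U': "open U'" "frame_point e u y \<in> U'"
      "U' \<subseteq> M \<and> U' \<inter> \<Union>P' = {} \<or> M \<inter> U' = \<Union>P' \<inter> U'"
      using aligned_part_local[OF D' e, of "frame_point e u y"] off by auto
    have in1: "(\<forall>z\<in>U. z \<in> M \<and> z \<notin> \<Union>P) \<or> (\<forall>z\<in>U. z \<in> M \<longleftrightarrow> z \<in> \<Union>P)"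
      using U(3) by blast
    have in2: "(\<forall>z\<in>U'. z \<in> M \<and> z \<notin> \<Union>P') \<or> (\<forall>z\<in>U'. z \<in> M \<longleftrightarrow> z \<in> \<Union>P')"
      using U'(3) by blast
    \<comment> \<open>If the same alternative holds for \<open>P\<close> and \<open>P'\<close>, then
      the two unions coincide on \<open>U \<inter> U'\<close>. In the mixed case
      \<open>U \<inter> U'\<close> lies in exactly one of them and is disjoint from the
      other.\<close>
    have "(\<forall>z\<in>U \<inter> U'. \<psi> z) \<or> (\<forall>z\<in>U \<inter> U'. \<not> \<psi> z)"
      using in1 in2 unfolding \<psi>_def by (metis IntE)
    with U U' show ?thesis by (intro exI[of _ "U \<inter> U'"]) auto
  qed
  have const: "\<psi> (frame_point e u y) = \<psi> (frame_point e v y)" for u v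
  proof (rule connected_local_const[where A = UNIV and f = "\<lambda>u. \<psi> (frame_point e u y)"])
    show "\<forall>a\<in>UNIV. \<forall>\<^sub>F b in at a. \<psi> (frame_point e a y) = \<psi> (frame_point e b y)"
    proof
      fix a :: real
      obtain V where V: "open V" "frame_point e a y \<in> V" "\<forall>z\<in>V. \<psi> z = \<psi> (frame_point e a y)"
        using nbhd by blast
      have "((\<lambda>b. frame_point e b y) \<longlongrightarrow> frame_point e a y) (at a)"
        by (intro tendsto_intros)
      then have "\<forall>\<^sub>F b in at a. frame_point e b y \<in> V"
        using V(1,2) by (rule topological_tendstoD)
      then show "\<forall>\<^sub>F b in at a. \<psi> (frame_point e a y) = \<psi> (frame_point e b y)"
        by eventually_elim (use V(3) in auto)
    qed
  qed auto
  \<comment> \<open>A coordinate to the left of all aligned tiles; the inserted \<open>0\<close>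
    keeps the set nonempty when there are none.\<close>
  define c where "c = Min (insert 0 (frame_lo e ` (P \<union> P'))) - 1"
  have c: "c < frame_lo e R" if "R \<in> P \<union> P'" for R
  proof -
    have "Min (insert 0 (frame_lo e ` (P \<union> P'))) \<le> frame_lo e R"
      using fin that by (intro Min_le) auto
    then show ?thesis by (simp add: c_def)
  qed
  have "frame_point e c y \<notin> R" if R: "R \<in> P \<union> P'" for R
  proof -
    have "R = frame_box e (frame_lo e R) (frame_hi e R) (frame_lo (\<i> * e) R) (frame_hi (\<i> * e) R)"
      using R(1) aligned_part_box(1)[OF D(2) e] aligned_part_box(1)[OF D'(2) e] by blast
    moreover have "c < frame_lo e R" using c R by blast
    ultimately show ?thesis
      using frame_point_inner[OF e] unfolding frame_box_def
      by (metis (mono_tags, lifting) leD mem_Collect_eq)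
  qed
  then have "\<psi> (frame_point e c y)" unfolding \<psi>_def by blast
  then show ?thesis using const[of x c] unfolding \<psi>_def by simp
qed

text \<open>The line through \<open>z\<close> may contain an edge or meet a tilted side at a
  critical point, but only finitely many heights are bad in this way. Moving \<open>z\<close>
  slightly to a good height changes no membership, as \<open>z\<close> is on no frontier of an
  aligned tile.\<close>

lemma aligned_unions_agree:
  assumes D: "dissection D M" "aligned_part e D P" and D': "dissection D' M" "aligned_part e D' P'"
    and e: "norm e = 1" and z: "\<And>R. R \<in> P \<union> P' \<Longrightarrow> z \<notin> frontier R"
  shows "z \<in> \<Union>P \<longleftrightarrow> z \<in> \<Union>P'"
proof -
  have fin: "finite (P \<union> P')" "finite ((D - P) \<union> (D' - P'))"
    using D D' by (auto simp: dissection_def aligned_part_def intro: finite_subset)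
  have clo: "closed R" if "R \<in> P \<union> P'" for R
    using that aligned_partD(2)[OF D(2), of R] aligned_partD(2)[OF D'(2), of R] closed_frame_box by auto
  obtain V where V: "open V" "z \<in> V" "\<forall>w\<in>V. \<forall>R\<in>P \<union> P'. w \<in> R \<longleftrightarrow> z \<in> R"
    using locally_constant_membership[OF fin(1) clo z] by blast
  define x where "x = e \<bullet> z"
  define y where "y = (\<i> * e) \<bullet> z"
  have zxy: "z = frame_point e x y" unfolding x_def y_def by (rule frame_decomp[OF e])
  \<comment> \<open>The heights that violate one of the two genericity hypotheses of
    \<open>aligned_unions_agree_on_line\<close>.\<close>
  define bad where "bad = (\<Union>R\<in>P \<union> P'. {frame_lo (\<i> * e) R, frame_hi (\<i> * e) R}) \<union>
    (\<Union>R\<in>P \<union> P'. \<Union>S\<in>(D - P) \<union> (D' - P'). \<Union>u\<in>{frame_lo e R, frame_hi e R}.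
       {v. frame_point e u v \<in> frontier S})"
  have "finite {v. frame_point e u v \<in> frontier S}" if "S \<in> (D - P) \<union> (D' - P')" for S u
    using that aligned_partD(3)[OF D(2), of S] aligned_partD(3)[OF D'(2), of S] finite_frontier_line
    by auto
  then have "finite bad" unfolding bad_def using fin by (intro finite_UnI finite_UN_I) auto
  \<comment> \<open>The height \<open>y\<close> itself may be bad; only a punctured neighbourhood of
    it has to avoid \<open>bad\<close>.\<close>
  then have "open (- (bad - {y}))" by (intro open_Compl finite_imp_closed finite_Diff)
  then have "\<forall>\<^sub>F v in at y. v \<notin> bad"
    unfolding eventually_at_topological by (intro exI[of _ "- (bad - {y})"]) auto
  moreover have "\<forall>\<^sub>F v in at y. frame_point e x v \<in> V"
  proof -
    have "((\<lambda>v. frame_point e x v) \<longlongrightarrow> frame_point e x y) (at y)" by (intro tendsto_intros)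
    then show ?thesis using V(1,2) zxy by (auto dest: topological_tendstoD)
  qed
  ultimately have "\<forall>\<^sub>F v in at y. v \<notin> bad \<and> frame_point e x v \<in> V"
    by (rule eventually_conj)
  then obtain v where v: "v \<notin> bad" "frame_point e x v \<in> V"
    using eventually_happens'[OF at_neq_bot] by blast
  have "frame_point e x v \<in> \<Union>P \<longleftrightarrow> frame_point e x v \<in> \<Union>P'"
    using v(1) by (intro aligned_unions_agree_on_line[OF D D' e]) (auto simp: bad_def)
  then show ?thesis using V(3) v(2) by blast
qed

section \<open>Forms on the tiles\<close>

text \<open>The \<open>m k\<close> and \<open>d k\<close> are the midpoints and the lengths of the gaps between consecutive points
  of \<open>G\<close>.\<close>
lemma subdivision:
  fixes G :: "real set"
  assumes "finite G"
  obtains I :: "nat set" and m d :: "nat \<Rightarrow> real" where "finite I" "\<And>k. k \<in> I \<Longrightarrow> m k \<notin> G"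
    "\<And>(f :: real \<Rightarrow> real) l r. (\<And>x y. f (x + y) = f x + f y) \<Longrightarrow> l \<in> G \<Longrightarrow> r \<in> G \<Longrightarrow> l \<le> r \<Longrightarrow>
       f (r - l) = (\<Sum>k\<in>I. if l < m k \<and> m k < r then f (d k) else 0)"
proof -
  define x where "x k = sorted_list_of_set G ! k" for k
  define n where "n = card G"
  define m where "m k = (x k + x (Suc k)) / 2" for k
  define d where "d k = x (Suc k) - x k" for k
  have len: "length (sorted_list_of_set G) = n" by (simp add: n_def)
  have mono: "x i < x j" if "i < j" "j < n" for i j
    using that strict_sorted_list_of_set[of G] unfolding x_def
    by (intro sorted_wrt_nth_less[of "(<)"]) (simp_all only: len)
  have mono': "x i \<le> x j" if "i \<le> j" "j < n" for i j
    using mono[of i j] that by (cases "i = j") auto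
  have G: "\<exists>k<n. g = x k" if "g \<in> G" for g
    using that assms len unfolding x_def by (metis in_set_conv_nth set_sorted_list_of_set)
  have mk: "x k < m k" "m k < x (Suc k)" if "Suc k < n" for k
    using mono[of k "Suc k"] that by (auto simp: m_def)
  \<comment> \<open>With \<open>above\<close>, this turns the position of a midpoint relative to
    points of \<open>G\<close> into a comparison of indices.\<close>
  have below: "m k < x b \<longleftrightarrow> k < b" if "Suc k < n" "b < n" for k b
    using mk[OF that(1)] mono'[of "Suc k" b] mono'[of b k] that by (cases "k < b") auto
  have above: "x a < m k \<longleftrightarrow> a \<le> k" if "Suc k < n" "a < n" for k a
    using mk[OF that(1)] mono'[of "Suc k" a] mono'[of a k] that by (cases "a \<le> k") auto
  show thesis
  \<comment> \<open>There is one gap fewer than points; truncated subtraction gives no gap for empty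
    \<open>G\<close>.\<close>
  proof (rule that[of "{..<n - 1}" m d])
    fix k assume "k \<in> {..<n - 1}"
    then have k: "Suc k < n" by auto
    show "m k \<notin> G"
    proof
      assume "m k \<in> G"
      then obtain b where b: "b < n" "m k = x b" using G by blast
      then show False using below[OF k b(1)] above[OF k b(1)] by auto
    qed
  next
    fix f :: "real \<Rightarrow> real" and l r
    assume add: "\<And>x y. f (x + y) = f x + f y" and lr: "l \<in> G" "r \<in> G" "l \<le> r"
    have diff: "f (u - v) = f u - f v" for u v
      using add[of "u - v" v] by simp
    obtain a b where a: "a < n" "l = x a" and b: "b < n" "r = x b" using G lr by blast
    have ab: "a \<le> b" using mono[of b a] a b lr(3) by (cases "a \<le> b") auto
    have "(\<Sum>k\<in>{..<n - 1}. if l < m k \<and> m k < r then f (d k) else 0)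
        = (\<Sum>k\<in>{..<n - 1}. if a \<le> k \<and> k < b then f (d k) else 0)"
      using a b below above by (intro sum.cong) auto
    also have "\<dots> = (\<Sum>k\<in>{a..<b}. f (d k))"
      using b by (intro sum.mono_neutral_cong_right) auto
    also have "\<dots> = (\<Sum>k\<in>{a..<b}. f (x (Suc k)) - f (x k))"
      by (simp add: d_def diff)
    also have "\<dots> = f (x b) - f (x a)" using ab by (rule sum_Suc_diff')
    finally show "f (r - l) = (\<Sum>k\<in>{..<n - 1}. if l < m k \<and> m k < r then f (d k) else 0)"
      using a b by (simp add: diff)
  qed simp
qed

text \<open>A Dehn-type invariant when \<open>B\<close> is biadditive; for the product form on
  aligned tiles it is their total area.\<close>

definition tile_sum :: "(real \<Rightarrow> real \<Rightarrow> real) \<Rightarrow> complex \<Rightarrow> complex set set \<Rightarrow> real" where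
  "tile_sum B e P = (\<Sum>R\<in>P. B (frame_hi e R - frame_lo e R) (frame_hi (\<i> * e) R - frame_lo (\<i> * e) R))"

text \<open>Cut all tiles along the grid lines through \<open>G\<close> and \<open>G'\<close>.
  Biadditivity splits the value of a tile into the values of its cells, and each cell is recognised
  by its midpoint. After swapping the sums, only membership of midpoints in \<open>\<Union>P\<close>
  matters.\<close>

lemma tile_sum_grid:
  fixes B :: "real \<Rightarrow> real \<Rightarrow> real"
  assumes D: "dissection D M" "aligned_part e D P" and e: "norm e = 1"
    and B: "\<And>x x' y. B (x + x') y = B x y + B x' y" "\<And>x y y'. B x (y + y') = B x y + B x y'"
    and fin: "finite I" "finite J"
    and I: "\<And>k. k \<in> I \<Longrightarrow> m k \<notin> G"
      "\<And>(f :: real \<Rightarrow> real) l r. (\<And>x y. f (x + y) = f x + f y) \<Longrightarrow> l \<in> G \<Longrightarrow> r \<in> G \<Longrightarrow> l \<le> r \<Longrightarrow>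
       f (r - l) = (\<Sum>k\<in>I. if l < m k \<and> m k < r then f (d k) else 0)"
    and J: "\<And>k. k \<in> J \<Longrightarrow> m' k \<notin> G'"
      "\<And>(f :: real \<Rightarrow> real) l r. (\<And>x y. f (x + y) = f x + f y) \<Longrightarrow> l \<in> G' \<Longrightarrow> r \<in> G' \<Longrightarrow> l \<le> r \<Longrightarrow>
       f (r - l) = (\<Sum>k\<in>J. if l < m' k \<and> m' k < r then f (d' k) else 0)"
    and G: "\<And>R. R \<in> P \<Longrightarrow> {frame_lo e R, frame_hi e R} \<subseteq> G"
      "\<And>R. R \<in> P \<Longrightarrow> {frame_lo (\<i> * e) R, frame_hi (\<i> * e) R} \<subseteq> G'"
  shows "tile_sum B e P =
    (\<Sum>k\<in>I. \<Sum>j\<in>J. if frame_point e (m k) (m' j) \<in> \<Union>P then B (d k) (d' j) else 0)"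
proof -
  have finP: "finite P" using D by (auto simp: dissection_def aligned_part_def intro: finite_subset)
  have e0: "e \<noteq> 0" using e by auto
  let ?p = "\<lambda>k j. frame_point e (m k) (m' j)"
  have mem: "?p k j \<in> R \<longleftrightarrow> (frame_lo e R < m k \<and> m k < frame_hi e R) \<and>
      (frame_lo (\<i> * e) R < m' j \<and> m' j < frame_hi (\<i> * e) R)" (is "_ \<longleftrightarrow> ?in")
    and int: "?p k j \<in> R \<Longrightarrow> ?p k j \<in> interior R" if R: "R \<in> P" and kj: "k \<in> I" "j \<in> J" for R k j
  proof -
    let ?R = "frame_box e (frame_lo e R) (frame_hi e R) (frame_lo (\<i> * e) R) (frame_hi (\<i> * e) R)"
    have eq: "R = ?R" using aligned_part_box(1)[OF D(2) e R] .
    \<comment> \<open>Midpoints avoid the grid lines, so strict and weak inequalities agree, and a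
      midpoint in a tile is interior to it.\<close>
    have ne: "m k \<notin> {frame_lo e R, frame_hi e R}" "m' j \<notin> {frame_lo (\<i> * e) R, frame_hi (\<i> * e) R}"
      using I(1)[OF kj(1)] J(1)[OF kj(2)] G[OF R] by blast+
    have "?p k j \<in> ?R \<longleftrightarrow> ?in"
      unfolding frame_box_def mem_Collect_eq frame_point_inner[OF e] using ne by auto
    moreover have "?p k j \<in> interior ?R \<longleftrightarrow> ?in"
      unfolding interior_frame_box[OF e0] mem_Collect_eq frame_point_inner[OF e] by auto
    ultimately show "?p k j \<in> R \<longleftrightarrow> ?in" "?p k j \<in> R \<Longrightarrow> ?p k j \<in> interior R"
      using eq by simp_all
  qed
  have one: "B (frame_hi e R - frame_lo e R) (frame_hi (\<i> * e) R - frame_lo (\<i> * e) R) =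
     (\<Sum>k\<in>I. \<Sum>j\<in>J. if ?p k j \<in> R then B (d k) (d' j) else 0)" if R: "R \<in> P" for R
  proof -
    note lt = aligned_part_box(2,3)[OF D(2) e R]
    have "B (frame_hi e R - frame_lo e R) (frame_hi (\<i> * e) R - frame_lo (\<i> * e) R) =
      (\<Sum>k\<in>I. if frame_lo e R < m k \<and> m k < frame_hi e R
        then B (d k) (frame_hi (\<i> * e) R - frame_lo (\<i> * e) R) else 0)"
      using G(1)[OF R] lt(1) by (intro I(2)[of "\<lambda>u. B u _"] B(1)) auto
    also have "\<dots> = (\<Sum>k\<in>I. \<Sum>j\<in>J. if ?p k j \<in> R then B (d k) (d' j) else 0)"
    proof (rule sum.cong[OF refl])
      fix k assume k: "k \<in> I"
      have "B (d k) (frame_hi (\<i> * e) R - frame_lo (\<i> * e) R) = (\<Sum>j\<in>J.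
         if frame_lo (\<i> * e) R < m' j \<and> m' j < frame_hi (\<i> * e) R then B (d k) (d' j) else 0)"
        using G(2)[OF R] lt(2) by (intro J(2) B(2)) auto
      then show "(if frame_lo e R < m k \<and> m k < frame_hi e R
        then B (d k) (frame_hi (\<i> * e) R - frame_lo (\<i> * e) R) else 0) =
        (\<Sum>j\<in>J. if ?p k j \<in> R then B (d k) (d' j) else 0)"
        using mem[OF R k] by (cases "frame_lo e R < m k \<and> m k < frame_hi e R") (auto cong: sum.cong)
    qed
    finally show ?thesis .
  qed
  have "tile_sum B e P = (\<Sum>R\<in>P. \<Sum>k\<in>I. \<Sum>j\<in>J. if ?p k j \<in> R then B (d k) (d' j) else 0)"
    unfolding tile_sum_def by (intro sum.cong refl one)
  also have "\<dots> = (\<Sum>k\<in>I. \<Sum>R\<in>P. \<Sum>j\<in>J. if ?p k j \<in> R then B (d k) (d' j) else 0)"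
    by (rule sum.swap)
  also have "\<dots> = (\<Sum>k\<in>I. \<Sum>j\<in>J. \<Sum>R\<in>P. if ?p k j \<in> R then B (d k) (d' j) else 0)"
    by (intro sum.cong refl sum.swap)
  also have "\<dots> = (\<Sum>k\<in>I. \<Sum>j\<in>J. if ?p k j \<in> \<Union>P then B (d k) (d' j) else 0)"
  proof (intro sum.cong refl)
    fix k j assume kj: "k \<in> I" "j \<in> J"
    show "(\<Sum>R\<in>P. if ?p k j \<in> R then B (d k) (d' j) else 0) =
      (if ?p k j \<in> \<Union>P then B (d k) (d' j) else 0)"
    proof (cases "?p k j \<in> \<Union>P")
      case True
      then obtain R where R: "R \<in> P" "?p k j \<in> R" by blast
      \<comment> \<open>A midpoint in two tiles would be a common interior point, so each cell is
        counted once.\<close>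
      have "?p k j \<notin> S" if S: "S \<in> P" "S \<noteq> R" for S
      proof
        assume "?p k j \<in> S"
        then have "?p k j \<in> interior S \<inter> interior R" using int S R kj by blast
        moreover have "S \<in> D" "R \<in> D" using aligned_partD(1)[OF D(2)] S R by auto
        ultimately show False
          using D(1) S(2) unfolding dissection_def pairwise_def by blast
      qed
      then have "(\<Sum>R\<in>P. if ?p k j \<in> R then B (d k) (d' j) else 0) =
        (\<Sum>S\<in>P. if S = R then B (d k) (d' j) else 0)"
        using R by (intro sum.cong refl) auto
      then show ?thesis using R finP True by simp
    next
      case False
      then have "(\<Sum>R\<in>P. if ?p k j \<in> R then B (d k) (d' j) else 0) = 0"
        by (intro sum.neutral) auto
      then show ?thesis using False by simp
    qed
  qed
  finally show ?thesis .
qed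

text \<open>On a grid containing the edges of both aligned parts, no cell midpoint is on a frontier,
  so both unions contain the same midpoints and both sums are the same sum over cells.\<close>

lemma tile_sum_invariant:
  fixes B :: "real \<Rightarrow> real \<Rightarrow> real"
  assumes D: "dissection D M" "aligned_part e D P" and D': "dissection D' M" "aligned_part e D' P'"
    and e: "norm e = 1"
    and B: "\<And>x x' y. B (x + x') y = B x y + B x' y" "\<And>x y y'. B x (y + y') = B x y + B x y'"
  shows "tile_sum B e P = tile_sum B e P'"
proof -
  have fin: "finite (P \<union> P')"
    using D D' by (auto simp: dissection_def aligned_part_def intro: finite_subset)
  define G where "G = (\<Union>R\<in>P \<union> P'. {frame_lo e R, frame_hi e R})"
  define G' where "G' = (\<Union>R\<in>P \<union> P'. {frame_lo (\<i> * e) R, frame_hi (\<i> * e) R})"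
  have "finite G" "finite G'" unfolding G_def G'_def using fin by auto
  obtain I :: "nat set" and m d where I: "finite I" "\<And>k. k \<in> I \<Longrightarrow> m k \<notin> G"
    "\<And>(f :: real \<Rightarrow> real) l r. (\<And>x y. f (x + y) = f x + f y) \<Longrightarrow> l \<in> G \<Longrightarrow> r \<in> G \<Longrightarrow> l \<le> r \<Longrightarrow>
       f (r - l) = (\<Sum>k\<in>I. if l < m k \<and> m k < r then f (d k) else 0)"
    by (rule subdivision[OF \<open>finite G\<close>]) blast
  obtain J :: "nat set" and m' d' where J: "finite J" "\<And>k. k \<in> J \<Longrightarrow> m' k \<notin> G'"
    "\<And>(f :: real \<Rightarrow> real) l r. (\<And>x y. f (x + y) = f x + f y) \<Longrightarrow> l \<in> G' \<Longrightarrow> r \<in> G' \<Longrightarrow> l \<le> r \<Longrightarrow>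
       f (r - l) = (\<Sum>k\<in>J. if l < m' k \<and> m' k < r then f (d' k) else 0)"
    by (rule subdivision[OF \<open>finite G'\<close>]) blast
  have agree: "frame_point e (m k) (m' j) \<in> \<Union>P \<longleftrightarrow> frame_point e (m k) (m' j) \<in> \<Union>P'"
    if kj: "k \<in> I" "j \<in> J" for k j
  proof (rule aligned_unions_agree[OF D D' e])
    fix R assume R: "R \<in> P \<union> P'"
    have eq: "R = frame_box e (frame_lo e R) (frame_hi e R) (frame_lo (\<i> * e) R) (frame_hi (\<i> * e) R)"
      using R(1) aligned_part_box(1)[OF D(2) e] aligned_part_box(1)[OF D'(2) e] by blast
    have "m k \<notin> {frame_lo e R, frame_hi e R}" "m' j \<notin> {frame_lo (\<i> * e) R, frame_hi (\<i> * e) R}"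
      using I(2)[OF kj(1)] J(2)[OF kj(2)] R unfolding G_def G'_def by blast+
    then show "frame_point e (m k) (m' j) \<notin> frontier R"
      using frontier_frame_box[OF e, of "frame_point e (m k) (m' j)"] eq
      unfolding frame_point_inner[OF e] by metis
  qed
  have "tile_sum B e P =
    (\<Sum>k\<in>I. \<Sum>j\<in>J. if frame_point e (m k) (m' j) \<in> \<Union>P then B (d k) (d' j) else 0)"
    by (rule tile_sum_grid[OF D e B I(1) J(1) I(2,3) J(2,3)]) (auto simp: G_def G'_def)
  also have "\<dots> = (\<Sum>k\<in>I. \<Sum>j\<in>J. if frame_point e (m k) (m' j) \<in> \<Union>P' then B (d k) (d' j) else 0)"
    using agree by (intro sum.cong refl) simp
  also have "\<dots> = tile_sum B e P'"
    by (rule tile_sum_grid[OF D' e B I(1) J(1) I(2,3) J(2,3), symmetric]) (auto simp: G_def G'_def)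
  finally show ?thesis .
qed

section \<open>Tiles of a prescribed ratio and the sign of forms\<close>

lemma has_side_ratio_frame:
  assumes "has_side_ratio y R"
  obtains s e x x' where "s > 0" "y * s > 0" "norm e = 1" "R = frame_box e x (x + s) x' (x' + y * s)"
  using assms unfolding has_side_ratio_def rectangle_iff_frame_box by auto

text \<open>By \<open>frame_cases\<close> a tile is either tilted or turned against \<open>e\<close>
  by quarter turns. Half turns keep the side of length \<open>s\<close> parallel to
  \<open>e\<close>; odd quarter turns exchange the sides, hence the two shapes.\<close>

lemma exists_aligned_part:
  assumes D: "dissection D M" "\<forall>R\<in>D. has_side_ratio y R" and e: "norm e = 1"
  obtains P where "aligned_part e D P"
    "\<And>R. R \<in> P \<longleftrightarrow> R \<in> D \<and> (\<exists>s>0. \<exists>x x'. R = frame_box e x (x + s) x' (x' + y * s) \<or>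
       R = frame_box e x (x + y * s) x' (x' + s))"
proof -
  define Q where "Q R \<longleftrightarrow> (\<exists>s>0. \<exists>x x'. R = frame_box e x (x + s) x' (x' + y * s) \<or>
       R = frame_box e x (x + y * s) x' (x' + s))" for R
  have cases: "Q R \<or> (\<exists>d l r b t. norm d = 1 \<and> d \<bullet> (\<i> * e) \<noteq> 0 \<and> (\<i> * d) \<bullet> (\<i> * e) \<noteq> 0 \<and>
        l < r \<and> b < t \<and> R = frame_box d l r b t)" and pos: "y > 0" if R: "R \<in> D" for R
  proof -
    obtain s d x x' where s: "s > 0" "y * s > 0" and d: "norm d = 1"
      and eq: "R = frame_box d x (x + s) x' (x' + y * s)"
      by (rule has_side_ratio_frame[OF bspec[OF D(2) R]])
    show "y > 0" using s zero_less_mult_pos2 by blast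
    show "Q R \<or> (\<exists>d l r b t. norm d = 1 \<and> d \<bullet> (\<i> * e) \<noteq> 0 \<and> (\<i> * d) \<bullet> (\<i> * e) \<noteq> 0 \<and>
        l < r \<and> b < t \<and> R = frame_box d l r b t)"
    proof (cases rule: frame_cases[OF e d])
      case 1
      have "x < x + s" "x' < x' + y * s" using s by auto
      with 1 d eq show ?thesis by blast
    next
      case 2
      then show ?thesis using eq s unfolding Q_def by blast
    next
      case 3
      have "R = frame_box e (- x - s) (- x - s + s) (- x' - y * s) (- x' - y * s + y * s)"
        unfolding eq 3 frame_box_rotate by (intro frame_box_cong) simp_all
      then show ?thesis using s unfolding Q_def by blast
    next
      case 4
      have "R = frame_box e (- x' - y * s) (- x' - y * s + y * s) x (x + s)"
        unfolding eq 4 frame_box_rotate by (intro frame_box_cong) simp_all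
      then show ?thesis using s unfolding Q_def by blast
    next
      case 5
      have "R = frame_box e x' (x' + y * s) (- x - s) (- x - s + s)"
        unfolding eq 5 frame_box_rotate by (intro frame_box_cong) simp_all
      then show ?thesis using s unfolding Q_def by blast
    qed
  qed
  have box: "\<exists>l r b t. l < r \<and> b < t \<and> R = frame_box e l r b t" if R: "R \<in> D" "Q R" for R
  proof -
    obtain s x x' where "s > 0" "R = frame_box e x (x + s) x' (x' + y * s) \<or>
       R = frame_box e x (x + y * s) x' (x' + s)" using R(2) unfolding Q_def by blast
    moreover have "x < x + s" "x' < x' + y * s" "x < x + y * s" "x' < x' + s"
      using pos[OF R(1)] \<open>s > 0\<close> by auto
    ultimately show ?thesis by blast
  qed
  have "aligned_part e D {R \<in> D. Q R}"
    unfolding aligned_part_def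
  proof (intro conjI ballI)
    fix R assume "R \<in> D - {R \<in> D. Q R}"
    then show "\<exists>d l r b t. norm d = 1 \<and> d \<bullet> (\<i> * e) \<noteq> 0 \<and> (\<i> * d) \<bullet> (\<i> * e) \<noteq> 0 \<and>
        l < r \<and> b < t \<and> R = frame_box d l r b t"
      using cases[of R] by simp
  qed (use box in auto)
  then show thesis by (rule that) (auto simp: Q_def)
qed

lemma frame_norm_decomp:
  assumes "norm e = 1"
  shows "(norm z)\<^sup>2 = (e \<bullet> z)\<^sup>2 + ((\<i> * e) \<bullet> z)\<^sup>2"
proof -
  have "(norm z)\<^sup>2 = (Re e * Re e + Im e * Im e) * (Re z * Re z + Im z * Im z)"
    unfolding frame_norm[OF assms] cmod_power2 by (simp add: power2_eq_square)
  then show ?thesis by (simp add: inner_complex_def power2_eq_square algebra_simps)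
qed

text \<open>An isometry takes the ends of a diagonal of \<open>R\<close> to two points of
  \<open>S\<close> at the same distance, which is at most the diagonal of \<open>S\<close>.\<close>

lemma congruent_rectangles_diagonal:
  assumes "rectangle_with_sides l m R" "rectangle_with_sides l' m' S" "congruent_sets R S"
  shows "l\<^sup>2 + m\<^sup>2 \<le> l'\<^sup>2 + m'\<^sup>2"
proof -
  obtain e x y where lm: "l > 0" "m > 0" and e: "norm e = 1" and R: "R = frame_box e x (x + l) y (y + m)"
    using assms(1) unfolding rectangle_iff_frame_box by blast
  obtain d x' y' where d: "norm d = 1" and S: "S = frame_box d x' (x' + l') y' (y' + m')"
    using assms(2) unfolding rectangle_iff_frame_box by blast
  obtain f :: "complex \<Rightarrow> complex" where f: "\<And>x y. dist (f x) (f y) = dist x y" "f ` R = S"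
    using assms(3) unfolding congruent_sets_def by blast
  let ?p = "frame_point e x y" and ?q = "frame_point e (x + l) (y + m)"
  have "?p \<in> R" "?q \<in> R"
    unfolding R frame_box_def mem_Collect_eq frame_point_inner[OF e] using lm by auto
  then have in': "f ?p \<in> S" "f ?q \<in> S" using f(2) by auto
  have "l\<^sup>2 + m\<^sup>2 = (dist ?q ?p)\<^sup>2"
    unfolding dist_norm frame_norm_decomp[OF e] inner_diff_right frame_point_inner[OF e] by simp
  also have "\<dots> = (norm (f ?q - f ?p))\<^sup>2" by (simp add: f(1) flip: dist_norm)
  also have "\<dots> \<le> l'\<^sup>2 + m'\<^sup>2"
    unfolding frame_norm_decomp[OF d] inner_diff_right
    using in' unfolding S frame_box_def mem_Collect_eq
    by (intro add_mono abs_le_square_iff[THEN iffD1]) auto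
  finally show ?thesis .
qed

text \<open>Symmetry gives additivity in the second argument, and it makes the value of a tile
  independent of which side is parallel to the frame vector.\<close>

definition sym_biadditive :: "(real \<Rightarrow> real \<Rightarrow> real) \<Rightarrow> bool" where
  "sym_biadditive B \<longleftrightarrow> (\<forall>u u' v. B (u + u') v = B u v + B u' v) \<and> (\<forall>u v. B u v = B v u)"

text \<open>Compare the tile sums of both dissections in the frame of one equal tile: the aligned
  equal tiles all contribute \<open>B 1 y\<close>, the aligned tiles of ratio \<open>x\<close>
  contribute nonnegative values, and the sums agree.\<close>

lemma bilinear_form_nonneg:
  assumes D: "dissection D M" "\<forall>R\<in>D. has_side_ratio y R" "\<forall>R\<in>D. \<forall>S\<in>D. congruent_sets R S"
    and D': "dissection D' M" "\<forall>R\<in>D'. has_side_ratio x R" and "M \<noteq> {}"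
    and B: "sym_biadditive B" and nonneg: "\<forall>t. B t (x * t) \<ge> 0"
  shows "B 1 y \<ge> 0"
proof -
  have sym: "B u v = B v u" and add: "B (u + u') v = B u v + B u' v" for u u' v
    using B by (auto simp: sym_biadditive_def)
  have add': "B u (v + v') = B u v + B u v'" for u v v'
    using add[of v v' u] sym by metis
  \<comment> \<open>The frame comes from this tile, so that \<open>P\<close> is nonempty and its
    cardinality can be divided out.\<close>
  obtain R0 where R0: "R0 \<in> D" using D(1) \<open>M \<noteq> {}\<close> unfolding dissection_def by auto
  obtain s e x0 x1 where s: "s > 0" "y * s > 0" and e: "norm e = 1"
    and R0eq: "R0 = frame_box e x0 (x0 + s) x1 (x1 + y * s)"
    by (rule has_side_ratio_frame[OF bspec[OF D(2) R0]])
  have y: "y > 0" using s zero_less_mult_pos2 by blast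
  have R0rect: "rectangle_with_sides s (y * s) R0"
    unfolding R0eq by (rule rectangle_frame_box[OF e s])
  obtain P where P: "aligned_part e D P"
    and P_iff: "\<And>R. R \<in> P \<longleftrightarrow> R \<in> D \<and> (\<exists>s>0. \<exists>x x'. R = frame_box e x (x + s) x' (x' + y * s) \<or>
       R = frame_box e x (x + y * s) x' (x' + s))"
    by (rule exists_aligned_part[OF D(1,2) e]) blast
  obtain P' where P': "aligned_part e D' P'"
    and P'_iff: "\<And>R. R \<in> P' \<longleftrightarrow> R \<in> D' \<and> (\<exists>s>0. \<exists>u v. R = frame_box e u (u + s) v (v + x * s) \<or>
       R = frame_box e u (u + x * s) v (v + s))"
    by (rule exists_aligned_part[OF D' e]) blast
  have "R0 \<in> P" using P_iff R0 R0eq s by blast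
  have finP: "finite P" using D(1) P by (auto simp: dissection_def aligned_part_def intro: finite_subset)
  \<comment> \<open>Rescaling the form instead of \<open>M\<close> turns the sides of the equal tiles into \<open>1\<close> and \<open>y\<close>.\<close>
  define B' where "B' u v = B (u / s) (v / s)" for u v
  have B'add: "B' (u + u') v = B' u v + B' u' v" "B' u (v + v') = B' u v + B' u v'" for u u' v v'
    by (simp_all add: B'_def add add' add_divide_distrib)
  have tile: "B' (frame_hi e R - frame_lo e R) (frame_hi (\<i> * e) R - frame_lo (\<i> * e) R) = B 1 y"
    if R: "R \<in> P" for R
  proof -
    obtain \<sigma> u v where \<sigma>: "\<sigma> > 0" "R = frame_box e u (u + \<sigma>) v (v + y * \<sigma>) \<or>
       R = frame_box e u (u + y * \<sigma>) v (v + \<sigma>)" and "R \<in> D"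
      using R P_iff by blast
    have y\<sigma>: "y * \<sigma> > 0" using y \<sigma> by simp
    then have rect: "rectangle_with_sides \<sigma> (y * \<sigma>) R"
      using \<sigma>(2) rectangle_frame_box[OF e \<sigma>(1) y\<sigma>] rectangle_frame_box[OF e y\<sigma> \<sigma>(1)] rectangle_swap
      by blast
    \<comment> \<open>Congruent tiles have equal diagonals, and with the common ratio this fixes the
      size.\<close>
    have "\<sigma>\<^sup>2 + (y * \<sigma>)\<^sup>2 = s\<^sup>2 + (y * s)\<^sup>2"
      using congruent_rectangles_diagonal[OF rect R0rect] congruent_rectangles_diagonal[OF R0rect rect]
        D(3) R0 \<open>R \<in> D\<close> by (meson antisym)
    then have "(1 + y\<^sup>2) * \<sigma>\<^sup>2 = (1 + y\<^sup>2) * s\<^sup>2" by (simp add: power_mult_distrib algebra_simps)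
    moreover have "1 + y\<^sup>2 > 0" by (simp add: add_pos_nonneg)
    ultimately have "\<sigma>\<^sup>2 = s\<^sup>2" by simp
    then have "\<sigma> = s" using \<sigma>(1) s(1) by (simp add: power2_eq_iff)
    then have "(frame_hi e R - frame_lo e R = s \<and> frame_hi (\<i> * e) R - frame_lo (\<i> * e) R = y * s) \<or>
      (frame_hi e R - frame_lo e R = y * s \<and> frame_hi (\<i> * e) R - frame_lo (\<i> * e) R = s)"
      using \<sigma>(2) frame_lo_hi[OF e] s by auto
    then show ?thesis
      using s(1) sym[of y 1] by (auto simp: B'_def)
  qed
  have "B' (frame_hi e R - frame_lo e R) (frame_hi (\<i> * e) R - frame_lo (\<i> * e) R) \<ge> 0"
    if R: "R \<in> P'" for R
  proof -
    obtain \<sigma> u v where \<sigma>: "\<sigma> > 0" "R = frame_box e u (u + \<sigma>) v (v + x * \<sigma>) \<or>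
       R = frame_box e u (u + x * \<sigma>) v (v + \<sigma>)"
      using R P'_iff by blast
    have "has_side_ratio x R" using D'(2) R P'_iff by blast
    then have x: "x > 0" unfolding has_side_ratio_def rectangle_with_sides_def
      using zero_less_mult_pos2 by blast
    then have x\<sigma>: "x * \<sigma> > 0" using \<sigma>(1) by simp
    have "(frame_hi e R - frame_lo e R = \<sigma> \<and> frame_hi (\<i> * e) R - frame_lo (\<i> * e) R = x * \<sigma>) \<or>
      (frame_hi e R - frame_lo e R = x * \<sigma> \<and> frame_hi (\<i> * e) R - frame_lo (\<i> * e) R = \<sigma>)"
      using \<sigma> frame_lo_hi[OF e] x\<sigma> by auto
    then show ?thesis
      using nonneg[rule_format, of "\<sigma> / s"] sym[of "x * \<sigma> / s" "\<sigma> / s"] by (auto simp: B'_def)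
  qed
  then have "tile_sum B' e P' \<ge> 0" unfolding tile_sum_def by (rule sum_nonneg)
  moreover have "tile_sum B' e P = real (card P) * B 1 y"
    unfolding tile_sum_def using tile by simp
  moreover have "tile_sum B' e P = tile_sum B' e P'"
    by (rule tile_sum_invariant[OF D(1) P D'(1) P' e B'add])
  moreover have "card P > 0" using finP \<open>R0 \<in> P\<close> card_gt_0_iff by blast
  ultimately show ?thesis by (simp add: zero_le_mult_iff)
qed

section \<open>Additive maps and the cone of ratios\<close>

definition rat_linear :: "(real \<Rightarrow> real) \<Rightarrow> bool" where
  "rat_linear f \<longleftrightarrow> (\<forall>s t. f (s + t) = f s + f t) \<and> (\<forall>q\<in>\<rat>. \<forall>t. f (q * t) = q * f t)"

text \<open>View the reals as a vector space over the rationals. The hypothesis puts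
  \<open>v\<close> outside the span of \<open>w1\<close> and \<open>w2\<close>, so some linear
  functional is 1 at \<open>v\<close> and 0 on that span.\<close>

lemma rat_functional:
  fixes v w1 w2 :: real
  assumes "\<And>c d. c \<in> \<rat> \<Longrightarrow> d \<in> \<rat> \<Longrightarrow> v \<noteq> c * w1 + d * w2"
  obtains f where "rat_linear f" "range f \<subseteq> \<rat>" "f w1 = 0" "f w2 = 0" "f v = 1"
proof -
  \<comment> \<open>The target space is \<open>rat\<close> rather than \<open>real\<close>; this
    yields rational values.\<close>
  let ?s1 = "\<lambda>(q::rat) (x::real). of_rat q * x" and ?s2 = "\<lambda>(q::rat) (x::rat). q * x"
  interpret vector_space_pair ?s1 ?s2
    by standard (auto simp: algebra_simps of_rat_mult of_rat_add)
  have v: "v \<notin> vs1.span {w1, w2}"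
  proof
    assume "v \<in> vs1.span {w1, w2}"
    then obtain k l where "v - of_rat k * w1 - of_rat l * w2 = 0"
      unfolding vs1.span_breakdown_eq vs1.span_empty by auto
    then have "v = of_rat k * w1 + of_rat l * w2" by simp
    then show False using assms[of "of_rat k" "of_rat l"] by simp
  qed
  \<comment> \<open>The vectors \<open>w1\<close>, \<open>w2\<close> may be dependent or zero, so a
    basis of their span is used.\<close>
  obtain W where W: "W \<subseteq> {w1, w2}" "vs1.independent W" "{w1, w2} \<subseteq> vs1.span W"
    using vs1.maximal_independent_subset by blast
  have vW: "v \<notin> vs1.span W" using v vs1.span_mono[OF W(1)] by blast
  then have "vs1.independent (insert v W)" using W(2) by (rule vs1.independent_insertI)
  then obtain g where g: "Vector_Spaces.linear ?s1 ?s2 g"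
    "\<forall>x\<in>insert v W. g x = (if x = v then 1 else 0)"
    using linear_independent_extend[of _ "\<lambda>x. if x = v then 1 else 0"] by blast
  have "v \<notin> W" using vW vs1.span_base by blast
  then have "g x = 0" if "x \<in> W" for x using g(2) that by auto
  then have zero: "g x = 0" if "x \<in> vs1.span W" for x
    using linear_eq_0_on_span[OF g(1)] that by blast
  have "(of_rat (g (q * t)) :: real) = q * of_rat (g t)" if q: "q \<in> \<rat>" for q t
  proof -
    obtain r where "q = of_rat r" using q by (rule Rats_cases)
    then show ?thesis
      using linear_scale[OF g(1), of r t] by (simp add: of_rat_mult)
  qed
  then have "rat_linear (\<lambda>t. of_rat (g t))"
    using linear_add[OF g(1)] by (simp add: rat_linear_def of_rat_add)
  then show thesis
    by (rule that) (use zero W(3) g(2) in auto)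
qed

text \<open>Maps that are semilinear over the conjugation of the field \<open>Qsqrt p\<close>; those
  with value 1 at 1 extend it.\<close>

definition conj_linear :: "real \<Rightarrow> (real \<Rightarrow> real) \<Rightarrow> bool" where
  "conj_linear p \<tau> \<longleftrightarrow> rat_linear \<tau> \<and> (\<forall>t. \<tau> (sqrt p * t) = - sqrt p * \<tau> t)"

lemma conj_linear_mult:
  assumes "conj_linear p \<tau>" "a \<in> \<rat>" "b \<in> \<rat>"
  shows "\<tau> ((a + b * sqrt p) * t) = (a - b * sqrt p) * \<tau> t"
proof -
  have "\<tau> ((a + b * sqrt p) * t) = \<tau> (a * t + b * (sqrt p * t))" by (simp add: algebra_simps)
  then show ?thesis using assms by (simp add: conj_linear_def rat_linear_def algebra_simps)
qed

text \<open>This is, up to a factor, the projection of \<open>f\<close> to its semilinear part: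
  since \<open>f (p * t) = p * f t\<close>, replacing \<open>t\<close> by \<open>sqrt p * t\<close>
  exchanges the two terms up to the factor \<open>- sqrt p\<close>.\<close>

lemma conj_linear_from_functional:
  assumes f: "rat_linear f" and p: "p \<in> \<rat>" "p > 0"
  shows "conj_linear p (\<lambda>t. c * (f t - f (sqrt p * t) / sqrt p))"
proof -
  have add: "f (s + t) = f s + f t" for s t using f by (simp add: rat_linear_def)
  have scale: "f (q * t) = q * f t" if "q \<in> \<rat>" for q t using f that by (simp add: rat_linear_def)
  have 1: "f (sqrt p * (q * t)) = q * f (sqrt p * t)" if "q \<in> \<rat>" for q t
    using scale[OF that, of "sqrt p * t"] by (simp add: mult.left_commute)
  have 2: "f (sqrt p * (sqrt p * t)) = p * f t" for t
    using scale[OF p(1), of t] p(2) by (simp flip: mult.assoc)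
  have 3: "p * u / sqrt p = sqrt p * u" for u
    using p(2) by (simp add: field_simps)
  have "rat_linear (\<lambda>t. c * (f t - f (sqrt p * t) / sqrt p))"
    unfolding rat_linear_def using 1
    by (simp add: add scale ring_distribs add_divide_distrib)
  moreover have "c * (f (sqrt p * t) - f (sqrt p * (sqrt p * t)) / sqrt p) =
      - sqrt p * (c * (f t - f (sqrt p * t) / sqrt p))" for t
    unfolding 2 3 using p(2) by (simp add: field_simps)
  ultimately show ?thesis unfolding conj_linear_def by blast
qed

lemma exists_conj_linear:
  assumes "p \<in> \<rat>" "p > 0" "sqrt p \<notin> \<rat>"
  obtains \<tau> where "conj_linear p \<tau>" "\<tau> 1 = 1"
proof -
  have "sqrt p \<noteq> c * 1 + d * 0" if "c \<in> \<rat>" "d \<in> \<rat>" for c d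
    using assms(3) that by auto
  then obtain f where f: "rat_linear f" "f 1 = 0" "f (sqrt p) = 1"
    using rat_functional by metis
  \<comment> \<open>Here \<open>f 1 - f (sqrt p) / sqrt p = - 1 / sqrt p\<close>, so the factor
    \<open>- sqrt p\<close> normalises the value at 1.\<close>
  show thesis
    by (rule that[OF conj_linear_from_functional[OF f(1) assms(1,2), of "- sqrt p"]])
      (use f assms in simp)
qed

text \<open>To a map with value 1 at 1, add a semilinear map that vanishes at 1 but not at
  \<open>y\<close>, scaled to correct the value at \<open>y\<close>.\<close>

lemma exists_conj_linear_value:
  assumes p: "p \<in> \<rat>" "p > 0" "sqrt p \<notin> \<rat>" and y: "y \<notin> Qsqrt p"
  obtains \<tau> where "conj_linear p \<tau>" "\<tau> 1 = 1" "\<tau> y = \<eta>"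
proof -
  obtain \<tau> where \<tau>: "conj_linear p \<tau>" "\<tau> 1 = 1" by (rule exists_conj_linear[OF p])
  have "y \<noteq> c * 1 + d * sqrt p" if "c \<in> \<rat>" "d \<in> \<rat>" for c d
    using y that unfolding Qsqrt_def by auto
  then obtain f where f: "rat_linear f" "range f \<subseteq> \<rat>" "f 1 = 0" "f (sqrt p) = 0" "f y = 1"
    using rat_functional by metis
  \<comment> \<open>The functional has rational values, so it cannot take the value
    \<open>sqrt p\<close>.\<close>
  have "f (sqrt p * y) / sqrt p \<noteq> 1"
  proof
    assume "f (sqrt p * y) / sqrt p = 1"
    then have "sqrt p = f (sqrt p * y)" using p(2) by (simp add: field_simps)
    then show False using f(2) p(3) by (metis rangeI subsetD)
  qed
  then have nz: "f y - f (sqrt p * y) / sqrt p \<noteq> 0" using f(5) by simp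
  define \<kappa> where "\<kappa> t = (\<eta> - \<tau> y) / (f y - f (sqrt p * y) / sqrt p) * (f t - f (sqrt p * t) / sqrt p)" for t
  have "conj_linear p \<kappa>"
    unfolding \<kappa>_def by (rule conj_linear_from_functional[OF f(1) p(1,2)])
  moreover have "\<kappa> 1 = 0" "\<kappa> y = \<eta> - \<tau> y"
    unfolding \<kappa>_def using f(3,4) nz by auto
  ultimately show thesis
    by (intro that[of "\<lambda>t. \<tau> t + \<kappa> t"])
      (use \<tau> in \<open>auto simp: conj_linear_def rat_linear_def algebra_simps\<close>)
qed

section \<open>From nonnegative forms to the cone of ratios\<close>

text \<open>All test forms built from a semilinear map are treated at once. At
  \<open>(t, x * t)\<close> the form is a quadratic form in \<open>t\<close> and
  \<open>\<tau> t\<close>, because \<open>\<tau> (x * t) = x' * \<tau> t\<close>; the mixed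
  coefficient contains the trace \<open>x + x' = 2 * a\<close>.\<close>

lemma conj_form_nonneg:
  fixes x y :: real
  assumes form: "\<forall>B. sym_biadditive B \<and> (\<forall>t. B t (x * t) \<ge> 0) \<longrightarrow> B 1 y \<ge> 0"
    and x: "x = a + b * sqrt p" "x' = a - b * sqrt p" and ab: "a \<in> \<rat>" "b \<in> \<rat>"
    and \<tau>: "conj_linear p \<tau>" "\<tau> 1 = 1"
    and nonneg: "\<And>t s. A * x * t\<^sup>2 + C * x' * s\<^sup>2 + E * (2 * a) * (t * s) \<ge> 0"
  shows "A * y + C * \<tau> y + E * (\<tau> y + y) \<ge> 0"
proof -
  define B where "B u v = A * (u * v) + C * (\<tau> u * \<tau> v) + E * (u * \<tau> v + \<tau> u * v)" for u v
  have add: "\<tau> (u + v) = \<tau> u + \<tau> v" for u v using \<tau>(1) by (simp add: conj_linear_def rat_linear_def)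
  have "B t (x * t) = A * x * t\<^sup>2 + C * x' * (\<tau> t)\<^sup>2 + E * (2 * a) * (t * \<tau> t)" for t
  proof -
    have "\<tau> (x * t) = x' * \<tau> t" using conj_linear_mult[OF \<tau>(1) ab, of t] by (simp add: x)
    moreover have "2 * a = x + x'" by (simp add: x)
    ultimately show ?thesis by (simp add: B_def power2_eq_square algebra_simps)
  qed
  then have "\<forall>t. B t (x * t) \<ge> 0" using nonneg by simp
  moreover have "sym_biadditive B"
    unfolding sym_biadditive_def B_def by (simp add: add algebra_simps)
  ultimately have "B 1 y \<ge> 0" using form by blast
  then show ?thesis by (simp add: B_def \<tau>(2))
qed

text \<open>The test forms first force \<open>y\<close> into the field containing \<open>x\<close>,
  and then into the cone spanned by \<open>x\<close> and \<open>1 / x\<close>. The cases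
  \<open>b = 0\<close> and \<open>a = 0\<close> have forms of their own.\<close>

lemma ratio_in_cone:
  fixes x y :: real
  assumes ab: "a \<in> \<rat>" "b \<in> \<rat>" and p: "p \<in> \<rat>" "p > 0" "sqrt p \<notin> \<rat>"
    and x: "x = a + b * sqrt p" "x > 0" and y: "y > 0"
    and form: "\<forall>B. sym_biadditive B \<and> (\<forall>t. B t (x * t) \<ge> 0) \<longrightarrow> B 1 y \<ge> 0"
  obtains U V where "U \<in> \<rat>" "V \<in> \<rat>" "U \<ge> 0" "V \<ge> 0" "y = U * x + V / x"
proof (cases "b = 0")
  case True
  then have xa: "x = a" using x by simp
  have "y \<in> \<rat>"
  proof (rule ccontr)
    assume "y \<notin> \<rat>"
    then have "y \<noteq> c * 1 + d * 0" if "c \<in> \<rat>" "d \<in> \<rat>" for c d using that by auto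
    then obtain f where f: "rat_linear f" "f 1 = 0" "f y = 1"
      using rat_functional by metis
    \<comment> \<open>The coefficient gives \<open>g 1 = 1\<close> and \<open>g y = - 1\<close>, so
      the form is negative at \<open>(1, y)\<close>, whereas at \<open>(t, x * t)\<close> it is
      \<open>x\<close> times a square.\<close>
    define g where "g t = t - (y + 1) * f t" for t
    have "g (x * t) = x * g t" for t
      using f(1) ab xa by (simp add: g_def rat_linear_def algebra_simps)
    then have "\<forall>t. g t * g (x * t) \<ge> 0"
      using x(2) by (simp add: mult.left_commute)
    moreover have "sym_biadditive (\<lambda>u v. g u * g v)"
      using f(1) by (simp add: sym_biadditive_def g_def rat_linear_def algebra_simps)
    ultimately have "g 1 * g y \<ge> 0"
      using form[rule_format, of "\<lambda>u v. g u * g v"] by blast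
    then show False using f(2,3) by (simp add: g_def)
  qed
  then show thesis using that[of "y / x" 0] x y ab xa by auto
next
  case b: False
  define x' where "x' = a - b * sqrt p"
  have x'0: "x' \<noteq> 0"
  proof
    assume "x' = 0"
    then have "sqrt p = a / b" using b by (simp add: x'_def field_simps)
    then show False using ab p(3) by auto
  qed
  have q: "sqrt p > 0" using p(2) by simp
  note form' = conj_form_nonneg[OF form x(1) x'_def ab]
  have y_in: "y \<in> Qsqrt p" if "A * x = 1" "C * x' = 1" "E * a = - 1" "C + E \<noteq> 0" for A C E
  proof (rule ccontr)
    assume "y \<notin> Qsqrt p"
    \<comment> \<open>The prescribed value solves
      \<open>(A + E) * y + (C + E) * \<tau> y = - 1\<close>.\<close>
    then obtain \<tau> where \<tau>: "conj_linear p \<tau>" "\<tau> 1 = 1" "\<tau> y = (- 1 - (A + E) * y) / (C + E)"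
      by (rule exists_conj_linear_value[OF p])
    have Ea: "E * (2 * a) = - 2" using that(3) by simp
    have "A * x * t\<^sup>2 + C * x' * s\<^sup>2 + E * (2 * a) * (t * s) = (t - s)\<^sup>2" for t s
      unfolding that(1,2) Ea by (simp add: power2_eq_square algebra_simps)
    then have "A * y + C * \<tau> y + E * (\<tau> y + y) \<ge> 0"
      by (intro form' \<tau>) auto
    moreover have "A * y + C * \<tau> y + E * (\<tau> y + y) = (A + E) * y + (C + E) * \<tau> y"
      by (simp add: algebra_simps)
    ultimately show False using that(4) \<tau>(3) by simp
  qed
  obtain \<tau> where \<tau>: "conj_linear p \<tau>" "\<tau> 1 = 1" by (rule exists_conj_linear[OF p])
  show thesis
  proof (cases "a = 0")
    case True
    \<comment> \<open>The trace of \<open>x\<close> vanishes, so the mixed form is zero at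
      \<open>(t, x * t)\<close> and may be used with both signs.\<close>
    have neg: "\<tau> y = - y" if "conj_linear p \<tau>" "\<tau> 1 = 1" for \<tau>
    proof -
      have "0 * y + 0 * \<tau> y + 1 * (\<tau> y + y) \<ge> 0" "0 * y + 0 * \<tau> y + (- 1) * (\<tau> y + y) \<ge> 0"
        by (rule form'[OF that]; simp add: True)+
      then show ?thesis by simp
    qed
    have "y \<in> Qsqrt p"
    proof (rule ccontr)
      assume "y \<notin> Qsqrt p"
      then obtain \<tau> where "conj_linear p \<tau>" "\<tau> 1 = 1" "\<tau> y = 1 - y"
        by (rule exists_conj_linear_value[OF p])
      then show False using neg[of \<tau>] by simp
    qed
    then obtain e f where ef: "e \<in> \<rat>" "f \<in> \<rat>" "y = e + f * sqrt p"
      unfolding Qsqrt_def by auto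
    have "\<tau> y = e - f * sqrt p" using conj_linear_mult[OF \<tau>(1) ef(1,2), of 1] \<tau>(2) ef(3) by simp
    then have "e = 0" using neg[OF \<tau>] ef(3) by simp
    then have "y = f / b * x" using ef(3) x(1) True b by simp
    moreover from this have "f / b \<ge> 0" using x(2) y by (metis less_eq_real_def zero_less_mult_pos2)
    ultimately show thesis using that[of "f / b" 0] ab ef by auto
  next
    case a: False
    have "1 / x' + - 1 / a \<noteq> 0"
    proof
      assume "1 / x' + - 1 / a = 0"
      then have "x' = a" using a x'0 by (simp add: field_simps)
      then show False using b q by (simp add: x'_def)
    qed
    then have "y \<in> Qsqrt p" using y_in[of "1 / x" "1 / x'" "- 1 / a"] x(2) x'0 a by simp
    then obtain e f where ef: "e \<in> \<rat>" "f \<in> \<rat>" "y = e + f * sqrt p"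
      unfolding Qsqrt_def by auto
    \<comment> \<open>The field norm of \<open>x\<close>. As \<open>N / x = x'\<close>, a multiple
      \<open>W * x'\<close> equals \<open>W * N / x\<close>, so the second coefficient will be
      \<open>W * N\<close>.\<close>
    define N where "N = a\<^sup>2 - p * b\<^sup>2"
    have sq: "sqrt p * sqrt p = p" using p(2) by simp
    have N: "N = x * x'"
      using sq unfolding N_def x x'_def by (simp add: power2_eq_square algebra_simps)
    have Nx: "N / x = x'" "N / x' = x" using N x(2) x'0 by auto
    have NQ: "N \<in> \<rat>" using ab p(1) by (simp add: N_def)
    \<comment> \<open>The coordinates of \<open>y\<close> in the rational basis \<open>x\<close>,
      \<open>x'\<close> of the field.\<close>
    define U where "U = (e / a + f / b) / 2"
    define W where "W = (e / a - f / b) / 2"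
    have "U + W = e / a" "U - W = f / b"
      by (simp_all add: U_def W_def add_divide_distrib diff_divide_distrib)
    then have e: "e = (U + W) * a" and f: "f = (U - W) * b" using a b by simp_all
    have yUW: "y = U * x + W * x'"
      unfolding ef(3) e f x x'_def by (simp add: algebra_simps)
    have \<tau>y: "\<tau> y = U * x' + W * x"
      using conj_linear_mult[OF \<tau>(1) ef(1,2), of 1] \<tau>(2) ef(3)
      unfolding ef(3) e f x x'_def by (simp add: algebra_simps)
    have dx: "x - x' \<noteq> 0" using b q by (simp add: x x'_def)
    have xx: "x + x' = 2 * a" by (simp add: x x'_def)
    have "(1 / x) * x * t\<^sup>2 + (1 / x') * x' * s\<^sup>2 + (- 1 / a) * (2 * a) * (t * s) = (t - s)\<^sup>2" for t s
      using x(2) x'0 a by (simp add: power2_eq_square algebra_simps)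
    then have "(1 / x) * y + (1 / x') * \<tau> y + (- 1 / a) * (\<tau> y + y) \<ge> 0"
      by (intro form' \<tau>) auto
    also have "(1 / x) * y + (1 / x') * \<tau> y + (- 1 / a) * (\<tau> y + y) =
      U + W * x' / x + U + W * x / x' - (U + W) * (x + x') / a"
      unfolding \<tau>y unfolding yUW using x(2) x'0 a by (simp add: field_simps)
    also have "\<dots> = W * (x - x')\<^sup>2 / N"
      unfolding xx N using x(2) x'0 a by (simp add: field_simps power2_eq_square)
    \<comment> \<open>The conjugate \<open>x'\<close>, and with it \<open>N\<close>, may be
      negative; a square is split off to isolate the sign of \<open>W * N\<close>.\<close>
    also have "\<dots> = (W * N) * ((x - x') / N)\<^sup>2"
      using N x(2) x'0 by (simp add: field_simps power2_eq_square)
    finally have V0: "W * N \<ge> 0"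
      using dx N x(2) x'0 by (simp add: zero_le_mult_iff)
    \<comment> \<open>The second form, the square of \<open>x * t - x' * s\<close>, isolates the
      sign of \<open>U\<close>.\<close>
    have "x * x * t\<^sup>2 + x' * x' * s\<^sup>2 + (- (N / a)) * (2 * a) * (t * s) = (x * t - x' * s)\<^sup>2" for t s
      using a by (simp add: N power2_eq_square algebra_simps)
    then have "x * y + x' * \<tau> y + (- (N / a)) * (\<tau> y + y) \<ge> 0"
      by (intro form' \<tau>) auto
    also have "x * y + x' * \<tau> y + (- (N / a)) * (\<tau> y + y) =
      U * (x\<^sup>2 + x'\<^sup>2) + 2 * W * N - N * (U + W) * ((x + x') / a)"
      unfolding \<tau>y unfolding yUW N using a by (simp add: field_simps power2_eq_square)
    also have "\<dots> = U * (x - x')\<^sup>2"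
      unfolding xx N using a by (simp add: power2_eq_square algebra_simps)
    finally have U0: "U \<ge> 0" using dx by (simp add: zero_le_mult_iff)
    show thesis
    proof (rule that[of U "W * N"])
      show "y = U * x + W * N / x" using Nx(1) yUW by (metis times_divide_eq_right)
    qed (use U0 V0 NQ ab ef in \<open>auto simp: U_def W_def\<close>)
  qed
qed

theorem mainTheorem1:
  fixes a b p y :: real and M :: "complex set" and C :: "complex list set"
  assumes "a \<in> \<rat>" and "b \<in> \<rat>" and "p \<in> \<rat>" and "p > 0" and "sqrt p \<notin> \<rat>"
    and "polygon M C"
    and "\<forall>vs\<in>C. \<forall>(u, v)\<in>sides vs. dist u v \<in> Qsqrt p"
    and "dissectable_into_equal M y"
  shows "dissectable_into_similar M (a + b * sqrt p) \<longleftrightarrow>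
    (\<exists>R. has_side_ratio y R \<and> dissectable_into_similar R (a + b * sqrt p))"
proof -
  obtain D where D: "dissection D M" "\<forall>R\<in>D. has_side_ratio y R" "\<forall>R\<in>D. \<forall>S\<in>D. congruent_sets R S"
    using assms(8) unfolding dissectable_into_equal_def by blast
  \<comment> \<open>A nonempty frontier makes \<open>M\<close> nonempty, so every dissection of
    \<open>M\<close> has a tile, and the ratios are positive.\<close>
  have "path_image (closed_polyline vs) \<noteq> {}" for vs by (simp add: path_image_def)
  then have "frontier M \<noteq> {}" using assms(6) unfolding polygon_def by auto
  then have M: "M \<noteq> {}" by auto
  have ratio_pos: "r > 0" if "has_side_ratio r R" for r R
    using that unfolding has_side_ratio_def rectangle_with_sides_def by (auto simp: zero_less_mult_iff)
  show ?thesis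
  proof
    assume "dissectable_into_similar M (a + b * sqrt p)"
    then obtain D' where D': "dissection D' M" "\<forall>R\<in>D'. has_side_ratio (a + b * sqrt p) R"
      unfolding dissectable_into_similar_def by blast
    have "D \<noteq> {}" "D' \<noteq> {}" using D(1) D'(1) M unfolding dissection_def by auto
    then have y: "y > 0" and x: "a + b * sqrt p > 0" using ratio_pos D(2) D'(2) by blast+
    have form: "\<forall>B. sym_biadditive B \<and> (\<forall>t. B t ((a + b * sqrt p) * t) \<ge> 0) \<longrightarrow> B 1 y \<ge> 0"
      using bilinear_form_nonneg[OF D D' M] by blast
    obtain U V where UV: "U \<in> \<rat>" "V \<in> \<rat>" "U \<ge> 0" "V \<ge> 0"
      "y = U * (a + b * sqrt p) + V / (a + b * sqrt p)"
      by (rule ratio_in_cone[OF assms(1-5) refl x y form])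
    from dissectable_rectangle_of_ratio[OF x this y]
    show "\<exists>R. has_side_ratio y R \<and> dissectable_into_similar R (a + b * sqrt p)" .
  next
    assume "\<exists>R. has_side_ratio y R \<and> dissectable_into_similar R (a + b * sqrt p)"
    then show "dissectable_into_similar M (a + b * sqrt p)"
      using dissectable_refine[OF D(1,2)] by blast
  qed
qed

end
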